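(* Let $M\ge 1$ and $m_1,\dots,m_M\in\mathbb{Z}_{\ge 1}$ be such that one of the following holds: (a) $M=1$ and $m_1\le 5$; (b) $M=2$ and $m_1+m_2\le 4$; (c) $M=3$ and $m_1=m_2=m_3=1$. Put $N=m_1+\dots+m_M$. Let $\gamma,\delta,s_0,\dots,s_M\in\mathbb{C}$, let $t_1,\dots,t_M\in\mathbb{C}$ be such that $0,1,t_1,\dots,t_M$ are mutually distinct, and set $$\tilde L=\frac{d^2}{dz^2}+\left(\frac{\gamma}{z}+\frac{\delta}{z-1}-\sum_{k=1}^M\frac{m_k}{z-t_k}\right)\frac{d}{dz}+\frac{s_Mz^M+\dots+s_0}{z(z-1)(z-t_1)\cdots(z-t_M)}.$$ Assume that the singularities $z=t_k$ of $\tilde L y=0$ are apparent for $k=1,\dots,M$. Let $\alpha,\beta\in\mathbb{C}$ be determined by $s_M=\alpha\beta$ and $\delta=\alpha+\beta-\gamma+N+1$. Then there exist $e_1,\dots,e_N\in\mathbb{C}$ and a differential operator $\tilde D$ in $z$ of order $N$ whose coefficients are rational functions such that $$L_{\alpha,\beta,e_1+1,\dots,e_N+1;\,\gamma,e_1,\dots,e_N}=\tilde D\,\tilde L .$$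
   Context: For complex parameters $a_1,\dots,a_{p+1},b_1,\dots,b_p$, the generalized hypergeometric differential operator $L_{a_1,\dots,a_{p+1};b_1,\dots,b_p}$ is the monic differential operator of order $p+1$ (leading term $d^{p+1}/dz^{p+1}$, coefficients rational in $z$) such that $L_{a_1,\dots,a_{p+1};b_1,\dots,b_p}\,y=0$ is equivalent to $$\left\{\frac{d}{dz}\left(z\frac{d}{dz}+b_1-1\right)\cdots\left(z\frac{d}{dz}+b_p-1\right)-\left(z\frac{d}{dz}+a_1\right)\cdots\left(z\frac{d}{dz}+a_{p+1}\right)\right\}y=0;$$ i.e. it is the operator in braces divided by its leading coefficient $z^p(1-z)$. The regular singularity $z=t_k$ of $\tilde Ly=0$ has exponents $0$ and $m_k+1$. It is called apparent if no local solution around $z=t_k$ contains a logarithmic term, equivalently if the local monodromy around $z=t_k$ is trivial (all local solutions are holomorphic at $z=t_k$). *)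

theory Defs
  imports "HOL-Complex_Analysis.Complex_Analysis" "HOL-Computational_Algebra.Computational_Algebra"
    "HOL-Computational_Algebra.Field_as_Ring"
begin

section \<open>Rational functions of one complex variable\<close>

type_synonym ratfun = "complex poly fract"

definition rf_const :: "complex \<Rightarrow> ratfun" where
  "rf_const c = to_fract [:c:]"

definition rf_z :: ratfun where
  "rf_z = to_fract [:0, 1:]"

text \<open>The numerator and denominator chosen by \<^const>\<open>quot_of_fract\<close> are coprime, so the
  zeros of the denominator are exactly the poles. The value at a pole is the junk value 0.\<close>

definition rf_pole :: "ratfun \<Rightarrow> complex \<Rightarrow> bool" where
  "rf_pole f z \<longleftrightarrow> poly (snd (quot_of_fract f)) z = 0"

definition rf_eval :: "ratfun \<Rightarrow> complex \<Rightarrow> complex" where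
  "rf_eval f z = poly (fst (quot_of_fract f)) z / poly (snd (quot_of_fract f)) z"

definition rf_deriv :: "ratfun \<Rightarrow> ratfun" where
  "rf_deriv f = (let (p, q) = quot_of_fract f in Fract (pderiv p * q - p * pderiv q) (q\<^sup>2))"

lemma rf_deriv_Fract:
  assumes "q \<noteq> 0"
  shows "rf_deriv (Fract p q) = Fract (pderiv p * q - p * pderiv q) (q\<^sup>2)"
proof -
  obtain a b where ab: "quot_of_fract (Fract p q) = (a, b)"
    by fastforce
  then have "Fract a b = Fract p q" and b: "b \<noteq> 0"
    using Fract_quot_of_fract[of "Fract p q"] snd_quot_of_fract_nonzero[of "Fract p q"] by auto
  then have eq: "a * q = p * b"
    using assms by (simp add: eq_fract)
  have "pderiv a * q + a * pderiv q = pderiv p * b + p * pderiv b"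
    using arg_cong[OF eq, of pderiv] by (simp add: pderiv_mult algebra_simps)
  with eq have "(pderiv a * b - a * pderiv b) * q\<^sup>2 = (pderiv p * q - p * pderiv q) * b\<^sup>2"
    by algebra
  then show ?thesis
    using assms b by (simp add: rf_deriv_def ab eq_fract)
qed

lemma rf_deriv_add: "rf_deriv (f + g) = rf_deriv f + rf_deriv g"
proof (cases f, cases g)
  fix a b c d assume "f = Fract a b" "b \<noteq> 0" "g = Fract c d" "d \<noteq> 0"
  then show ?thesis
    by (simp add: rf_deriv_Fract eq_fract pderiv_add pderiv_mult power2_eq_square algebra_simps)
qed

lemma rf_deriv_mult: "rf_deriv (f * g) = rf_deriv f * g + f * rf_deriv g"
proof (cases f, cases g)
  fix a b c d assume "f = Fract a b" "b \<noteq> 0" "g = Fract c d" "d \<noteq> 0"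
  then show ?thesis
    by (simp add: rf_deriv_Fract eq_fract pderiv_add pderiv_mult power2_eq_square algebra_simps)
qed

lemma rf_deriv_0 [simp]: "rf_deriv 0 = 0"
  by (simp add: Zero_fract_def rf_deriv_Fract eq_fract)

lemma rf_deriv_1 [simp]: "rf_deriv 1 = 0"
  by (simp add: One_fract_def Zero_fract_def rf_deriv_Fract eq_fract)

lemma rf_deriv_const [simp]: "rf_deriv (rf_const c) = 0"
  by (simp add: rf_const_def to_fract_def rf_deriv_Fract fract_collapse)

lemma rf_deriv_z [simp]: "rf_deriv rf_z = 1"
  by (simp add: rf_z_def to_fract_def rf_deriv_Fract One_fract_def pderiv_pCons eq_fract flip: one_pCons)


section \<open>The ring of differential operators with rational coefficients\<close>

text \<open>The operator \<open>\<Sum>i. c\<^sub>i (d/dz)\<^sup>i\<close> is represented by the polynomial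
  with coefficients \<open>c\<^sub>i\<close>. Addition is that of polynomials; multiplication is composition of
  operators, determined by \<open>(d/dz) f = f (d/dz) + f'\<close>.\<close>

typedef diffop = "UNIV :: ratfun poly set"
  morphisms diffop_poly Diffop ..

setup_lifting type_definition_diffop

text \<open>Left multiplication by \<open>d/dz\<close>.\<close>

definition ore_shift :: "ratfun poly \<Rightarrow> ratfun poly" where
  "ore_shift q = pCons 0 q + map_poly rf_deriv q"

definition ore_mult :: "ratfun poly \<Rightarrow> ratfun poly \<Rightarrow> ratfun poly" where
  "ore_mult p q = (\<Sum>i\<le>degree p. smult (coeff p i) ((ore_shift ^^ i) q))"

lemma ore_shift_0 [simp]: "ore_shift 0 = 0"
  by (simp add: ore_shift_def)

lemma ore_shift_add: "ore_shift (p + q) = ore_shift p + ore_shift q"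
proof -
  have "map_poly rf_deriv (p + q) = map_poly rf_deriv p + map_poly rf_deriv q"
    by (rule poly_eqI) (simp add: coeff_map_poly rf_deriv_add)
  then show ?thesis
    by (simp add: ore_shift_def)
qed

lemma ore_shift_smult: "ore_shift (smult a p) = smult a (ore_shift p) + smult (rf_deriv a) p"
proof -
  have "map_poly rf_deriv (smult a p) = smult a (map_poly rf_deriv p) + smult (rf_deriv a) p"
    by (rule poly_eqI) (simp add: coeff_map_poly rf_deriv_mult)
  then show ?thesis
    by (simp add: ore_shift_def smult_add_right)
qed

lemma ore_shift_pCons: "ore_shift (pCons a p) = pCons (rf_deriv a) (pCons a 0 + ore_shift p)"
proof -
  have "map_poly rf_deriv (pCons a p) = pCons (rf_deriv a) (map_poly rf_deriv p)"
    by (rule poly_eqI) (simp add: coeff_map_poly coeff_pCons split: nat.split)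
  then show ?thesis
    by (simp add: ore_shift_def add.assoc[symmetric])
qed

lemma ore_mult_0_left [simp]: "ore_mult 0 q = 0"
  by (simp add: ore_mult_def)

lemma ore_mult_pCons: "ore_mult (pCons a p) q = smult a q + ore_mult p (ore_shift q)"
proof (cases "p = 0")
  case True
  then show ?thesis
    by (simp add: ore_mult_def)
next
  case False
  then have "ore_mult (pCons a p) q
      = (\<Sum>i\<le>Suc (degree p). smult (coeff (pCons a p) i) ((ore_shift ^^ i) q))"
    by (simp add: ore_mult_def)
  also have "\<dots> = smult a q + (\<Sum>i\<le>degree p. smult (coeff p i) ((ore_shift ^^ Suc i) q))"
    by (simp only: sum.atMost_Suc_shift coeff_pCons_0 coeff_pCons_Suc funpow_0)
  also have "\<dots> = smult a q + ore_mult p (ore_shift q)"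
    by (simp add: ore_mult_def funpow_swap1)
  finally show ?thesis .
qed

lemma ore_mult_add_right: "ore_mult p (q + r) = ore_mult p q + ore_mult p r"
  by (induction p arbitrary: q r) (simp_all add: ore_mult_pCons ore_shift_add smult_add_right)

lemma ore_mult_0_right [simp]: "ore_mult p 0 = 0"
  by (induction p) (simp_all add: ore_mult_pCons)

lemma ore_mult_add_left: "ore_mult (p + q) r = ore_mult p r + ore_mult q r"
proof (induction p arbitrary: q r)
  case (pCons a p)
  show ?case
    by (cases q) (simp add: ore_mult_pCons pCons.IH smult_add_left)
qed simp

lemma ore_mult_smult_left: "ore_mult (smult a p) q = smult a (ore_mult p q)"
  by (induction p arbitrary: q) (simp_all add: ore_mult_pCons smult_add_right)

lemma ore_mult_shift_left: "ore_mult (ore_shift p) q = ore_shift (ore_mult p q)"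
proof (induction p arbitrary: q)
  case (pCons a p)
  have "ore_mult (ore_shift (pCons a p)) q
      = smult (rf_deriv a) q + (smult a (ore_shift q) + ore_mult (ore_shift p) (ore_shift q))"
    by (simp add: ore_shift_pCons ore_mult_pCons ore_mult_add_left)
  also have "\<dots> = ore_shift (ore_mult (pCons a p) q)"
    by (simp add: ore_mult_pCons ore_shift_add ore_shift_smult pCons.IH)
  finally show ?case .
qed simp

lemma ore_mult_assoc: "ore_mult (ore_mult p q) r = ore_mult p (ore_mult q r)"
  by (induction p arbitrary: q r)
    (simp_all add: ore_mult_pCons ore_mult_add_left ore_mult_smult_left ore_mult_shift_left)

lemma ore_mult_1_left: "ore_mult 1 q = q"
  by (simp add: one_pCons ore_mult_pCons)

lemma ore_mult_1_right: "ore_mult p 1 = p"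
proof -
  have shift: "(ore_shift ^^ i) 1 = monom 1 i" for i
  proof (induction i)
    case (Suc i)
    have "map_poly rf_deriv (monom 1 i) = 0"
      by (rule poly_eqI) (simp add: coeff_map_poly)
    with Suc show ?case
      by (simp add: ore_shift_def monom_Suc)
  qed simp
  show ?thesis
    by (simp add: ore_mult_def shift smult_monom poly_as_sum_of_monoms)
qed

instantiation diffop :: ring_1
begin

lift_definition zero_diffop :: diffop is 0 .
lift_definition one_diffop :: diffop is 1 .
lift_definition plus_diffop :: "diffop \<Rightarrow> diffop \<Rightarrow> diffop" is "(+)" .
lift_definition minus_diffop :: "diffop \<Rightarrow> diffop \<Rightarrow> diffop" is "(-)" .
lift_definition uminus_diffop :: "diffop \<Rightarrow> diffop" is uminus .
lift_definition times_diffop :: "diffop \<Rightarrow> diffop \<Rightarrow> diffop" is ore_mult .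

instance
  by standard (simp_all add: diffop_poly_inject[symmetric] zero_diffop.rep_eq one_diffop.rep_eq
    plus_diffop.rep_eq minus_diffop.rep_eq uminus_diffop.rep_eq times_diffop.rep_eq
    ore_mult_assoc ore_mult_1_left ore_mult_1_right ore_mult_add_left ore_mult_add_right)

end

definition diffop_coeff :: "diffop \<Rightarrow> nat \<Rightarrow> ratfun" where
  "diffop_coeff L = coeff (diffop_poly L)"

text \<open>The zero operator gets order 0.\<close>

definition diffop_order :: "diffop \<Rightarrow> nat" where
  "diffop_order L = degree (diffop_poly L)"

text \<open>Multiplication by a rational function, and differentiation, as operators.\<close>

definition mult_op :: "ratfun \<Rightarrow> diffop" where
  "mult_op f = Diffop [:f:]"

definition d_dz :: diffop where
  "d_dz = Diffop [:0, 1:]"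

lemma d_dz_mult_op: "d_dz * mult_op f = mult_op f * d_dz + mult_op (rf_deriv f)"
  by (simp add: mult_op_def d_dz_def times_diffop.abs_eq plus_diffop.abs_eq eq_onp_def
      ore_mult_pCons ore_shift_pCons)

definition rf_apply :: "diffop \<Rightarrow> ratfun \<Rightarrow> ratfun" where
  "rf_apply L f = (\<Sum>i\<le>diffop_order L. diffop_coeff L i * (rf_deriv ^^ i) f)"

lemma rf_apply_mult: "rf_apply (K * L) f = rf_apply K (rf_apply L f)"
proof -
  define ap where "ap p f = (\<Sum>i\<le>degree p. coeff p i * (rf_deriv ^^ i) f)"
    for p :: "ratfun poly" and f
  have ap_0: "ap 0 f = 0" for f
    by (simp add: ap_def)
  have ap_pCons: "ap (pCons a p) f = a * f + ap p (rf_deriv f)" for a p f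
  proof (cases "p = 0")
    case False
    then have "ap (pCons a p) f = (\<Sum>i\<le>Suc (degree p). coeff (pCons a p) i * (rf_deriv ^^ i) f)"
      by (simp add: ap_def)
    also have "\<dots> = a * f + (\<Sum>i\<le>degree p. coeff p i * (rf_deriv ^^ Suc i) f)"
      by (simp only: sum.atMost_Suc_shift coeff_pCons_0 coeff_pCons_Suc funpow_0)
    finally show ?thesis
      by (simp add: ap_def funpow_swap1)
  qed (simp add: ap_def)
  have ap_add: "ap (p + q) f = ap p f + ap q f" for p q f
  proof (induction p arbitrary: q f)
    case (pCons a p)
    show ?case
      by (cases q) (simp add: ap_pCons pCons.IH, simp add: algebra_simps)
  qed (simp add: ap_0)
  have ap_smult: "ap (smult a p) f = a * ap p f" for a p f
    by (induction p arbitrary: f) (simp_all add: ap_0 ap_pCons algebra_simps)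
  have ap_shift: "ap (ore_shift p) f = rf_deriv (ap p f)" for p f
    by (induction p arbitrary: f)
      (simp_all add: ap_0 ap_pCons ap_add ore_shift_pCons rf_deriv_add rf_deriv_mult)
  have "ap (ore_mult p q) f = ap p (ap q f)" for p q f
    by (induction p arbitrary: q f)
      (simp_all add: ap_0 ap_pCons ap_add ap_smult ap_shift ore_mult_pCons)
  moreover have "rf_apply L = ap (diffop_poly L)" for L
    by (simp add: fun_eq_iff rf_apply_def ap_def diffop_order_def diffop_coeff_def)
  ultimately show ?thesis
    by (simp add: times_diffop.rep_eq)
qed


section \<open>Local solutions and apparent singularities\<close>

definition solves_on :: "diffop \<Rightarrow> complex set \<Rightarrow> (complex \<Rightarrow> complex) \<Rightarrow> bool" where
  "solves_on L U y \<longleftrightarrow> y holomorphic_on U \<and>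
     (\<forall>z\<in>U. (\<Sum>i\<le>diffop_order L. rf_eval (diffop_coeff L i) z * (deriv ^^ i) y z) = 0)"

text \<open>A singularity of a monic operator is apparent if all local solutions are holomorphic there.
  As solutions near the singular point \<open>t\<close> are a priori multivalued, a local solution is taken to
  be a branch on some domain in a punctured disc around \<open>t\<close> that contains no pole of
  the coefficients; it is required to extend holomorphically to the whole disc.\<close>

definition apparent_at :: "diffop \<Rightarrow> complex \<Rightarrow> bool" where
  "apparent_at L t \<longleftrightarrow> (\<exists>r>0.
     (\<forall>z\<in>ball t r - {t}. \<forall>i. \<not> rf_pole (diffop_coeff L i) z) \<and>
     (\<forall>U y. open U \<and> connected U \<and> U \<noteq> {} \<and> U \<subseteq> ball t r - {t} \<and> solves_on L U y \<longrightarrow>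
        (\<exists>Y. Y holomorphic_on ball t r \<and> (\<forall>z\<in>U. Y z = y z))))"


section \<open>Hypergeometric operators and Fuchsian operators of second order\<close>

text \<open>The generalized hypergeometric operator with upper parameters \<open>as\<close> and lower parameters
  \<open>bs\<close> is meant for \<open>length as = length bs + 1\<close>. With \<open>p = length bs\<close>, the difference
  of the two products below has leading coefficient \<open>z\<^sup>p (1 - z)\<close>, so dividing by it gives a
  monic operator of order \<open>p + 1\<close>.\<close>

definition euler_op :: "complex \<Rightarrow> diffop" where
  "euler_op c = mult_op rf_z * d_dz + mult_op (rf_const c)"

definition hypergeom_op :: "complex list \<Rightarrow> complex list \<Rightarrow> diffop" where
  "hypergeom_op as bs =
     mult_op (1 / (rf_z ^ length bs * (1 - rf_z))) *
     (d_dz * prod_list (map (\<lambda>b. euler_op (b - 1)) bs) - prod_list (map euler_op as))"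

definition L_tilde ::
  "complex \<Rightarrow> complex \<Rightarrow> nat \<Rightarrow> (nat \<Rightarrow> nat) \<Rightarrow> (nat \<Rightarrow> complex) \<Rightarrow> (nat \<Rightarrow> complex) \<Rightarrow> diffop" where
  "L_tilde \<gamma> \<delta> M m t s =
     d_dz ^ 2
     + mult_op (rf_const \<gamma> / rf_z + rf_const \<delta> / (rf_z - 1)
         - (\<Sum>k=1..M. of_nat (m k) / (rf_z - rf_const (t k)))) * d_dz
     + mult_op ((\<Sum>j\<le>M. rf_const (s j) * rf_z ^ j)
         / (rf_z * (rf_z - 1) * (\<Prod>k=1..M. rf_z - rf_const (t k))))"

end

theory Submission
  imports Defs "Jordan_Normal_Form.Determinant"
begin

text \<open>
  Write \<open>\<theta> = z d/dz\<close>. Multiplied by \<open>z\<^sup>2 (z - 1) (z - t\<^sub>1) \<dots> (z - t\<^sub>M)\<close>, the operator \<open>L~\<close> becomes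
  \<open>L = \<Sum>j\<le>M+1. z\<^sup>j q\<^sub>j(\<theta>)\<close> with polynomials \<open>q\<^sub>j\<close> of degree at most 2, where \<open>q\<^sub>0\<close> is a constant times
  \<open>\<theta> (\<theta> + \<gamma> - 1)\<close> and the last one is \<open>(\<theta> + \<alpha>) (\<theta> + \<beta>)\<close>. With \<open>E(x) = (x + e\<^sub>1) \<dots> (x + e\<^sub>N)\<close>
  the hypergeometric operator is, up to a rational factor on the left,
  \<open>\<theta> (\<theta> + \<gamma> - 1) E(\<theta> - 1) - z (\<theta> + \<alpha>) (\<theta> + \<beta>) E(\<theta> + 1)\<close>. Hence a left multiple of \<open>L\<close>
  is needed in which only the powers \<open>z\<^sup>0\<close> and \<open>z\<^sup>1\<close> are left.

  Every apparent singularity allows one division. As \<open>G(\<theta>) z\<^sup>j = z\<^sup>j G(\<theta> + j)\<close>, the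
  operator \<open>G(\<theta>) L\<close> is divisible by \<open>z - t\<close> on the left if the polynomial
  \<open>T G = \<Sum>j. t\<^sup>j G(x + j) q\<^sub>j(x)\<close> vanishes (\<open>divide_by_linear\<close>). At \<open>t = t\<^sub>k\<close>
  the map \<open>T\<close> raises the degree \<open>d\<close> of a polynomial by at most one, and the new leading coefficient is a
  nonzero multiple of \<open>d - m\<^sub>k\<close>. Therefore some monic \<open>G\<^sub>k\<close> of degree \<open>m\<^sub>k\<close> is mapped
  to a constant (\<open>exists_mellin_op_const\<close>). Applied to a solution \<open>y\<close> of \<open>L y = 0\<close> holomorphic at \<open>t\<^sub>k\<close>
  and evaluated there, \<open>G\<^sub>k(\<theta>) L\<close> gives that constant times \<open>y(t\<^sub>k)\<close>; so the constant
  is 0 as soon as \<open>y(t\<^sub>k) \<noteq> 0\<close>. Such a \<open>y\<close> exists because the singularity is apparent: the two-dimensional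
  solution space consists of functions holomorphic at \<open>t\<^sub>k\<close>, and those vanishing at \<open>t\<^sub>k\<close>
  have exponent \<open>m\<^sub>k + 1\<close> and form a space of dimension one
  (\<open>apparent_nonvanishing_solution\<close>).

  It remains to combine the operators \<open>(z - t\<^sub>k)\<^sup>-\<^sup>1 G\<^sub>k(\<theta>) L\<close>, which
  are polynomial in \<open>z\<close>. The coefficients of \<open>z\<^sup>i\<close> in a combination with left factors
  \<open>A\<^sub>k(\<theta>)\<close> are built from the sums \<open>c\<^sub>l = \<Sum>k. A\<^sub>k(x) t\<^sub>k\<^sup>l G\<^sub>k(x + l)\<close>. If the \<open>A\<^sub>k\<close> are cofactors of
  the Casorati matrix of the sequences \<open>t\<^sub>k\<^sup>x G\<^sub>k(x)\<close>, then all \<open>c\<^sub>l\<close> with \<open>0 < l < M\<close>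
  vanish, and \<open>c\<^sub>0\<close>, \<open>c\<^sub>M\<close> are the Casoratian \<open>\<Delta>(x)\<close> and a multiple of \<open>\<Delta>(x + 1)\<close>
  (\<open>casoratian_left_multiple\<close>). What is left is the hypergeometric operator with \<open>E(x)\<close> proportional to
  \<open>\<Delta>(x + 1)\<close>. The degree of \<open>\<Delta>\<close> is exactly \<open>m\<^sub>1 + \<dots> + m\<^sub>M\<close>: its top coefficient is the
  Vandermonde determinant of \<open>t\<^sub>1, \<dots>, t\<^sub>M\<close>. The order of the left factor follows because orders
  of operators are additive.
\<close>

hide_const (open) Module.smult

text \<open>Products of linear factors are kept factored.\<close>

declare mult_pCons_left [simp del] mult_pCons_right [simp del]

section \<open>Polynomials in the Euler operator\<close>

lemma mult_op_0 [simp]: "mult_op 0 = 0"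
  by (simp add: mult_op_def zero_diffop_def)

lemma mult_op_1 [simp]: "mult_op 1 = 1"
  by (simp add: mult_op_def one_diffop_def one_pCons)

lemma mult_op_add: "mult_op (f + g) = mult_op f + mult_op g"
  by (simp add: mult_op_def plus_diffop.abs_eq eq_onp_def)

lemma mult_op_mult: "mult_op (f * g) = mult_op f * mult_op g"
  by (simp add: mult_op_def times_diffop.abs_eq eq_onp_def ore_mult_pCons)

lemma mult_op_uminus: "mult_op (- f) = - mult_op f"
  by (simp add: mult_op_def uminus_diffop.abs_eq eq_onp_def)

lemma mult_op_diff: "mult_op (f - g) = mult_op f - mult_op g"
  using mult_op_add[of f "- g"] by (simp add: mult_op_uminus)

lemma mult_op_power: "mult_op (f ^ n) = mult_op f ^ n"
  by (induction n) (simp_all add: mult_op_mult)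

lemma mult_op_sum: "mult_op (sum f A) = (\<Sum>i\<in>A. mult_op (f i))"
  by (induction A rule: infinite_finite_induct) (simp_all add: mult_op_add)

lemma mult_op_commute: "mult_op f * mult_op g = mult_op g * mult_op f"
  by (simp add: mult.commute flip: mult_op_mult)

lemma rf_const_0 [simp]: "rf_const 0 = 0"
  and rf_const_1 [simp]: "rf_const 1 = 1"
  by (simp_all add: rf_const_def flip: one_pCons)

lemma rf_const_add: "rf_const (a + b) = rf_const a + rf_const b"
  by (simp add: rf_const_def flip: to_fract_add)

lemma rf_const_mult: "rf_const (a * b) = rf_const a * rf_const b"
  by (simp add: rf_const_def mult_pCons_left flip: to_fract_mult)

lemma rf_const_uminus: "rf_const (- a) = - rf_const a"
  by (simp add: rf_const_def flip: to_fract_uminus)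

abbreviation zop :: diffop
  where "zop \<equiv> mult_op rf_z"

abbreviation cop :: "complex \<Rightarrow> diffop"
  where "cop c \<equiv> mult_op (rf_const c)"

abbreviation theta :: diffop
  where "theta \<equiv> mult_op rf_z * d_dz"

lemma cop_commute_zop: "cop c * zop = zop * cop c"
  by (rule mult_op_commute)

lemma theta_mult_op: "theta * mult_op f = mult_op f * theta + mult_op (rf_z * rf_deriv f)"
  by (simp add: mult.assoc d_dz_mult_op distrib_left mult_op_mult)
    (metis mult.assoc mult_op_commute)

lemma cop_commute_theta: "cop c * theta = theta * cop c"
  by (simp add: theta_mult_op)

definition theta_poly :: "complex poly \<Rightarrow> diffop"
  where "theta_poly p = fold_coeffs (\<lambda>a L. cop a + theta * L) p 0"

lemma theta_poly_0 [simp]: "theta_poly 0 = 0"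
  by (simp add: theta_poly_def)

lemma theta_poly_pCons [simp]: "theta_poly (pCons a p) = cop a + theta * theta_poly p"
  by (cases "p = 0 \<and> a = 0") (auto simp: theta_poly_def)

lemma theta_poly_add: "theta_poly (p + q) = theta_poly p + theta_poly q"
  by (induction p q rule: poly_induct2) (simp_all add: rf_const_add mult_op_add algebra_simps)

lemma theta_poly_smult: "theta_poly (smult c p) = cop c * theta_poly p"
proof (induction p)
  case (pCons a p)
  have "cop c * (theta * theta_poly p) = theta * (cop c * theta_poly p)"
    by (metis cop_commute_theta mult.assoc)
  with pCons show ?case
    by (simp add: rf_const_mult mult_op_mult distrib_left)
qed simp

lemma theta_poly_mult: "theta_poly (p * q) = theta_poly p * theta_poly q"
  by (induction p) (simp_all add: mult_pCons_left theta_poly_add theta_poly_smult distrib_right mult.assoc)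

lemma theta_poly_sum: "theta_poly (sum f A) = (\<Sum>i\<in>A. theta_poly (f i))"
  by (induction A rule: infinite_finite_induct) (simp_all add: theta_poly_add)

lemma theta_poly_prod_list: "theta_poly (prod_list ps) = prod_list (map theta_poly ps)"
  by (induction ps) (simp_all add: theta_poly_mult one_pCons)

lemma euler_op_eq_theta_poly: "euler_op c = theta_poly [:c, 1:]"
  by (simp add: euler_op_def add.commute)

abbreviation shift_poly :: "nat \<Rightarrow> complex poly \<Rightarrow> complex poly"
  where "shift_poly j p \<equiv> pcompose p [:of_nat j, 1:]"

lemma shift_poly_shift_poly: "shift_poly i (shift_poly j p) = shift_poly (i + j) p"
  by (simp add: pcompose_pCons mult_pCons_left flip: pcompose_assoc) (simp add: add.commute)

lemma shift_poly_0 [simp]: "pcompose p [:0, 1:] = (p :: complex poly)"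
  by (induction p) (simp_all add: pcompose_pCons)

text \<open>Because \<open>\<theta> z = z (\<theta> + 1)\<close>.\<close>

lemma theta_poly_zop: "theta_poly p * zop = zop * theta_poly (shift_poly 1 p)"
proof (induction p)
  case (pCons a p)
  have "theta * (zop * theta_poly (shift_poly 1 p))
      = zop * (theta * theta_poly (shift_poly 1 p)) + zop * theta_poly (shift_poly 1 p)"
    using theta_mult_op[of rf_z] by (simp add: distrib_right flip: mult.assoc)
  with pCons show ?case
    by (simp add: pcompose_pCons theta_poly_add theta_poly_mult algebra_simps mult.assoc cop_commute_zop)
qed simp

lemma theta_poly_zop_power: "theta_poly p * zop ^ j = zop ^ j * theta_poly (shift_poly j p)"
proof (induction j arbitrary: p)
  case (Suc j)
  have "theta_poly p * zop ^ Suc j = zop * (theta_poly (shift_poly 1 p) * zop ^ j)"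
    by (simp add: theta_poly_zop flip: mult.assoc)
  also have "\<dots> = zop ^ Suc j * theta_poly (shift_poly (Suc j) p)"
    using shift_poly_shift_poly[where i = j and j = 1] by (simp add: Suc.IH mult.assoc add.commute)
  finally show ?case .
qed simp

section \<open>Expansions in powers of z with coefficients in the Euler operator\<close>

text \<open>\<open>sing2\<close>, \<open>sing1\<close> and \<open>sing0\<close> are the polynomial coefficients of \<open>\<theta> (\<theta> - 1)\<close>, \<open>\<theta>\<close> and 1 after
  \<open>L~\<close> is multiplied by \<open>z\<^sup>2 (z - 1) (z - t\<^sub>1) \<dots> (z - t\<^sub>M)\<close>. The \<open>t\<^sub>k\<close> are indexed from 0 here, to match
  the indices of matrices below.\<close>

definition sing2 :: "nat \<Rightarrow> (nat \<Rightarrow> complex) \<Rightarrow> complex poly" where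
  "sing2 M u = [:-1, 1:] * (\<Prod>k<M. [:- u k, 1:])"

definition sing1 :: "complex \<Rightarrow> complex \<Rightarrow> nat \<Rightarrow> (nat \<Rightarrow> nat) \<Rightarrow> (nat \<Rightarrow> complex) \<Rightarrow> complex poly" where
  "sing1 \<gamma> \<delta> M \<mu> u = smult \<gamma> (sing2 M u) + smult \<delta> ([:0, 1:] * (\<Prod>k<M. [:- u k, 1:]))
     - (\<Sum>k<M. smult (of_nat (\<mu> k)) ([:0, 1:] * [:-1, 1:] * (\<Prod>l\<in>{..<M} - {k}. [:- u l, 1:])))"

definition sing0 :: "nat \<Rightarrow> (nat \<Rightarrow> complex) \<Rightarrow> complex poly" where
  "sing0 M s = [:0, 1:] * (\<Sum>j\<le>M. monom (s j) j)"

lemma sing2_nonzero [simp]: "sing2 M u \<noteq> 0"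
  by (simp add: sing2_def)

lemma poly_sing2: "poly (sing2 M u) z = (z - 1) * (\<Prod>k<M. z - u k)"
  by (simp add: sing2_def poly_prod)

lemma poly_sing2_root: "k < M \<Longrightarrow> poly (sing2 M u) (u k) = 0"
  by (auto simp: poly_sing2)

lemma sing2_split:
  assumes "k < M"
  shows "sing2 M u = [:- u k, 1:] * ([:-1, 1:] * (\<Prod>l\<in>{..<M} - {k}. [:- u l, 1:]))"
  using assms by (simp add: sing2_def prod.remove[of "{..<M}" k] algebra_simps)

lemma poly_pderiv_sing2:
  assumes "k < M"
  shows "poly (pderiv (sing2 M u)) (u k) = (u k - 1) * (\<Prod>l\<in>{..<M} - {k}. u k - u l)"
  by (subst sing2_split[OF assms], subst pderiv_mult) (simp add: pderiv_pCons poly_prod)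

lemma poly_pderiv_sing2_nonzero:
  assumes "k < M" and "inj_on u {..<M}" and "1 \<notin> u ` {..<M}"
  shows "poly (pderiv (sing2 M u)) (u k) \<noteq> 0"
  using assms by (auto simp: poly_pderiv_sing2 inj_on_def)

text \<open>The residue of the coefficient of \<open>d/dz\<close> at \<open>u k\<close> is \<open>- \<mu> k\<close>; this makes the exponents there
  0 and \<open>\<mu> k + 1\<close>.\<close>

lemma poly_sing1_root:
  assumes "k < M"
  shows "poly (sing1 \<gamma> \<delta> M \<mu> u) (u k) = - of_nat (\<mu> k) * u k * poly (pderiv (sing2 M u)) (u k)"
proof -
  have 1: "poly (\<Prod>k<M. [:- u k, 1:]) (u k) = 0"
    using assms by (auto simp: poly_prod)
  have 2: "poly (\<Prod>l\<in>{..<M} - {j}. [:- u l, 1:]) (u k) = 0" if "j \<noteq> k" for j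
    using assms that by (auto simp: poly_prod)
  have "(\<Sum>j<M. of_nat (\<mu> j) * (u k * (u k - 1) * poly (\<Prod>l\<in>{..<M} - {j}. [:- u l, 1:]) (u k)))
      = of_nat (\<mu> k) * (u k * (u k - 1) * poly (\<Prod>l\<in>{..<M} - {k}. [:- u l, 1:]) (u k))"
    using assms by (subst sum.remove[of _ k]) (auto intro!: sum.neutral simp: 2)
  then show ?thesis
    using assms by (simp add: sing1_def poly_sing2_root 1 poly_sum poly_pderiv_sing2)
      (simp add: poly_prod algebra_simps)
qed

text \<open>The coefficient of \<open>z\<^sup>j\<close> when an operator is written as \<open>\<Sum>j. z\<^sup>j q\<^sub>j(\<theta>)\<close>.\<close>

definition euler_coeff :: "complex poly \<Rightarrow> complex poly \<Rightarrow> complex poly \<Rightarrow> nat \<Rightarrow> complex poly" where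
  "euler_coeff b2 b1 b0 j =
     smult (coeff b2 j) ([:0, 1:] * [:-1, 1:]) + smult (coeff b1 j) [:0, 1:] + [:coeff b0 j:]"

lemma degree_prod_linear [simp]: "degree (\<Prod>k\<in>A. [:- u k, 1 :: complex:]) = card A"
  by (subst degree_prod_eq_sum_degree) auto

lemma lead_coeff_prod_linear: "coeff (\<Prod>k\<in>A. [:- u k, 1 :: complex:]) (card A) = 1"
  using lead_coeff_prod[of "\<lambda>k. [:- u k, 1:]" A] by simp

lemma degree_sing2: "degree (sing2 M u) = Suc M"
  by (simp add: sing2_def degree_mult_eq)

lemma degree_sing1: "degree (sing1 \<gamma> \<delta> M \<mu> u) \<le> Suc M"
proof -
  have "degree ([:0, 1:] * [:-1, 1:] * (\<Prod>l\<in>{..<M} - {k}. [:- u l, 1:])) = Suc M" if "k < M" for k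
    using that by (simp add: degree_mult_eq)
  then have "degree (\<Sum>k<M. smult (of_nat (\<mu> k)) ([:0, 1:] * [:-1, 1:] * (\<Prod>l\<in>{..<M} - {k}. [:- u l, 1:])))
      \<le> Suc M"
    by (intro degree_sum_le) (auto intro: order.trans[OF degree_smult_le])
  moreover have "degree (smult \<gamma> (sing2 M u)) \<le> Suc M"
    using degree_smult_le[of \<gamma> "sing2 M u"] by (simp only: degree_sing2)
  moreover have "degree ([:0, 1:] * (\<Prod>k<M. [:- u k, 1:])) = Suc M"
    by (simp add: degree_mult_eq)
  then have "degree (smult \<delta> ([:0, 1:] * (\<Prod>k<M. [:- u k, 1:]))) \<le> Suc M"
    using degree_smult_le[of \<delta> "[:0, 1:] * (\<Prod>k<M. [:- u k, 1:])"] by (simp only:)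
  ultimately show ?thesis
    unfolding sing1_def by (intro degree_diff_le degree_add_le)
qed

lemma degree_sing0: "degree (sing0 M s) \<le> Suc M"
  unfolding sing0_def
  by (rule order.trans[OF degree_mult_le])
    (auto intro!: degree_sum_le order.trans[OF degree_monom_le])

lemma coeff_sing2_0: "coeff (sing2 M u) 0 = - (\<Prod>k<M. - u k)"
  by (simp add: poly_sing2 flip: poly_0_coeff_0)

lemma coeff_sing1_0: "coeff (sing1 \<gamma> \<delta> M \<mu> u) 0 = \<gamma> * coeff (sing2 M u) 0"
  by (simp add: sing1_def poly_sum flip: poly_0_coeff_0)

lemma coeff_sing0_0: "coeff (sing0 M s) 0 = 0"
  by (simp add: sing0_def mult_pCons_left)

lemma coeff_sing2_top: "coeff (sing2 M u) (Suc M) = 1"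
  using lead_coeff_prod_linear[of u "{..<M}"] lead_coeff_mult[of "[:-1, 1:]" "\<Prod>k<M. [:- u k, 1:]"]
  by (simp add: sing2_def degree_mult_eq)

text \<open>With \<open>coeff_sing2_top\<close> and \<open>coeff_sing0_top\<close> this gives the last Euler coefficient
  \<open>x (x - 1) + (\<gamma> + \<delta> - N) x + s\<^sub>M\<close> with \<open>N = \<Sum>k<M. \<mu> k\<close>, whose roots are the negatives of
  the exponents at infinity.\<close>

lemma coeff_sing1_top:
  "coeff (sing1 \<gamma> \<delta> M \<mu> u) (Suc M) = \<gamma> + \<delta> - of_nat (\<Sum>k<M. \<mu> k)"
proof -
  have C: "coeff ([:0, 1:] * [:-1, 1:] * (\<Prod>l\<in>{..<M} - {k}. [:- u l, 1:])) (Suc M) = 1" if "k < M" for k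
  proof -
    define r where "r = [:0, 1:] * [:-1, 1:] * (\<Prod>l\<in>{..<M} - {k}. [:- u l, 1:])"
    have "degree r = Suc M"
      using that by (simp add: r_def degree_mult_eq)
    moreover have "lead_coeff r = 1"
      unfolding r_def lead_coeff_mult lead_coeff_prod by simp
    ultimately show ?thesis
      by (simp add: r_def)
  qed
  have B: "coeff ([:0, 1:] * (\<Prod>k<M. [:- u k, 1:])) (Suc M) = 1"
    using lead_coeff_prod_linear[of u "{..<M}"] by (simp add: mult_pCons_left)
  show ?thesis
    unfolding sing1_def coeff_diff coeff_add coeff_smult coeff_sum coeff_sing2_top B
    by (auto intro!: sum.cong simp: C)
qed

lemma coeff_sing0_top: "coeff (sing0 M s) (Suc M) = s M"
  by (simp add: sing0_def mult_pCons_left coeff_sum if_distrib cong: if_cong)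

lemma to_fract_prod: "to_fract (prod f A) = (\<Prod>k\<in>A. to_fract (f k :: complex poly))"
  by (induction A rule: infinite_finite_induct) simp_all

lemma to_fract_sum: "to_fract (sum f A) = (\<Sum>k\<in>A. to_fract (f k :: complex poly))"
  by (induction A rule: infinite_finite_induct) simp_all

lemma to_fract_smult: "to_fract (smult c p) = rf_const c * to_fract p"
  by (simp add: rf_const_def mult_pCons_left flip: to_fract_mult)

lemma to_fract_linear: "to_fract [:- a, 1:] = rf_z - rf_const a"
  by (simp add: rf_z_def rf_const_def flip: to_fract_diff)

lemma to_fract_pCons: "to_fract (pCons a p) = rf_const a + rf_z * to_fract p"
  by (simp add: rf_z_def rf_const_def mult_pCons_left flip: to_fract_mult to_fract_add)

lemma to_fract_monom: "to_fract (monom a n) = rf_const a * rf_z ^ n"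
  by (induction n) (simp_all add: monom_0 monom_Suc to_fract_pCons)

lemma rf_const_of_nat: "rf_const (of_nat n) = of_nat n"
  by (induction n) (simp_all add: rf_const_add)

lemma linear_nonzero: "rf_z - rf_const a \<noteq> 0"
  by (simp flip: to_fract_linear)

lemma rf_z_neq_const [simp]: "rf_z \<noteq> rf_const a"
  using linear_nonzero[of a] by auto

lemma rf_z_nonzero [simp]: "rf_z \<noteq> 0" and rf_z_neq_1 [simp]: "rf_z \<noteq> 1"
  using rf_z_neq_const[of 0] rf_z_neq_const[of 1] by (simp_all del: rf_z_neq_const)

text \<open>Multiplying by \<open>z\<^sup>2\<close> and the common denominator of the coefficients turns \<open>L~\<close> into
  \<open>b\<^sub>2(z) \<theta> (\<theta> - 1) + b\<^sub>1(z) \<theta> + b\<^sub>0(z)\<close> with the polynomials \<open>b\<^sub>2\<close>, \<open>b\<^sub>1\<close>, \<open>b\<^sub>0\<close> given by \<open>sing2\<close>,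
  \<open>sing1\<close>, \<open>sing0\<close>.\<close>

lemma L_tilde_eq:
  fixes \<gamma> \<delta> :: complex and M :: nat and m :: "nat \<Rightarrow> nat" and s t :: "nat \<Rightarrow> complex"
  defines "b2 \<equiv> to_fract (sing2 M (t \<circ> Suc))"
    and "b1 \<equiv> to_fract (sing1 \<gamma> \<delta> M (m \<circ> Suc) (t \<circ> Suc))"
    and "b0 \<equiv> to_fract (sing0 M s)"
  shows "L_tilde \<gamma> \<delta> M m t s
    = d_dz ^ 2 + mult_op (b1 / (rf_z * b2)) * d_dz + mult_op (b0 / (rf_z\<^sup>2 * b2))"
proof -
  define P where "P = (\<Prod>k<M. rf_z - rf_const (t (Suc k)))"
  have P: "P \<noteq> 0"
    by (auto simp: P_def)
  have b2: "b2 = (rf_z - 1) * P"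
    using to_fract_linear[of 1] by (simp add: b2_def sing2_def P_def to_fract_prod to_fract_linear)
  have lin: "to_fract [:0, 1:] = rf_z" "to_fract [:-1, 1:] = rf_z - 1"
    using to_fract_linear[of 0] to_fract_linear[of 1] by simp_all
  have rest: "(\<Prod>l\<in>{..<M} - {k}. rf_z - rf_const (t (Suc l))) = P / (rf_z - rf_const (t (Suc k)))"
    if "k < M" for k
    using that by (simp add: P_def prod.remove[of "{..<M}" k])
  have b1: "b1 = rf_const \<gamma> * b2 + rf_const \<delta> * (rf_z * P)
      - (\<Sum>k<M. of_nat (m (Suc k)) * (rf_z * (rf_z - 1) * (P / (rf_z - rf_const (t (Suc k))))))"
    unfolding b1_def sing1_def b2_def
    by (simp add: to_fract_sum to_fract_smult to_fract_prod lin to_fract_linear rf_const_of_nat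
        P_def[symmetric]) (auto intro!: sum.cong simp: rest)
  have "(\<Sum>k<M. of_nat (m (Suc k)) * (rf_z * (rf_z - 1) * (P / (rf_z - rf_const (t (Suc k))))))
      = rf_z * b2 * (\<Sum>k<M. of_nat (m (Suc k)) / (rf_z - rf_const (t (Suc k))))"
    unfolding sum_distrib_left b2 by (intro sum.cong refl)
      (simp only: times_divide_eq_right times_divide_eq_left mult.assoc mult.commute mult.left_commute)
  note C = this
  have b2_nz: "b2 \<noteq> 0"
    using P by (simp add: b2)
  have "rf_const \<gamma> * b2 / (rf_z * b2) = rf_const \<gamma> / rf_z"
    using b2_nz by simp
  moreover have "rf_const \<delta> * (rf_z * P) / (rf_z * b2) = rf_const \<delta> / (rf_z - 1)"
    using P by (simp add: b2)
  moreover have "rf_z * b2 * S / (rf_z * b2) = S" for S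
    using b2_nz by simp
  ultimately have c1: "b1 / (rf_z * b2) = rf_const \<gamma> / rf_z + rf_const \<delta> / (rf_z - 1)
      - (\<Sum>k=1..M. of_nat (m k) / (rf_z - rf_const (t k)))"
    unfolding b1 C One_nat_def sum.atLeast1_atMost_eq diff_divide_distrib add_divide_distrib by (simp only:)
  have b0: "b0 = rf_z * (\<Sum>j\<le>M. rf_const (s j) * rf_z ^ j)"
    by (simp add: b0_def sing0_def to_fract_sum to_fract_monom lin)
  have c0: "b0 / (rf_z\<^sup>2 * b2) = (\<Sum>j\<le>M. rf_const (s j) * rf_z ^ j)
      / (rf_z * (rf_z - 1) * (\<Prod>k=1..M. rf_z - rf_const (t k)))"
    unfolding b0 b2 One_nat_def prod.atLeast1_atMost_eq P_def[symmetric] power2_eq_square mult.assoc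
    by (rule mult_divide_mult_cancel_left, rule rf_z_nonzero)
  show ?thesis
    unfolding L_tilde_def c1 c0 by (rule refl)
qed

lemma mult_op_to_fract:
  assumes "degree p \<le> n"
  shows "mult_op (to_fract p) = (\<Sum>j\<le>n. zop ^ j * cop (coeff p j))"
proof -
  have "to_fract p = (\<Sum>j\<le>n. rf_z ^ j * rf_const (coeff p j))"
    by (subst poly_as_sum_of_monoms'[OF assms, symmetric])
      (simp add: to_fract_sum to_fract_monom mult.commute)
  then show ?thesis
    by (simp add: mult_op_sum mult_op_mult mult_op_power)
qed

lemma theta_square: "theta * (theta - 1) = zop ^ 2 * d_dz ^ 2"
proof -
  have d: "d_dz * zop = zop * d_dz + 1"
    using d_dz_mult_op[of rf_z] by simp
  have "theta * (theta - 1) = zop * (d_dz * zop) * d_dz - zop * d_dz"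
    by (simp add: right_diff_distrib mult.assoc)
  also have "\<dots> = zop * (zop * d_dz) * d_dz"
    unfolding d by (simp add: distrib_left distrib_right)
  finally show ?thesis
    by (simp add: power2_eq_square mult.assoc)
qed

lemma euler_form:
  assumes b2: "b2 \<noteq> 0" and "degree b2 \<le> n" "degree b1 \<le> n" "degree b0 \<le> n"
  shows "mult_op (rf_z\<^sup>2 * to_fract b2) * (d_dz ^ 2 + mult_op (to_fract b1 / (rf_z * to_fract b2)) * d_dz
      + mult_op (to_fract b0 / (rf_z\<^sup>2 * to_fract b2)))
    = (\<Sum>j\<le>n. zop ^ j * theta_poly (euler_coeff b2 b1 b0 j))"
proof -
  have e: "rf_z\<^sup>2 * to_fract b2 = to_fract b2 * rf_z\<^sup>2"
    "rf_z\<^sup>2 * to_fract b2 * (to_fract b1 / (rf_z * to_fract b2)) = to_fract b1 * rf_z"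
    "rf_z\<^sup>2 * to_fract b2 * (to_fract b0 / (rf_z\<^sup>2 * to_fract b2)) = to_fract b0"
    using b2 by (simp_all add: power2_eq_square)
  have "mult_op (rf_z\<^sup>2 * to_fract b2) * (d_dz ^ 2 + mult_op (to_fract b1 / (rf_z * to_fract b2)) * d_dz
      + mult_op (to_fract b0 / (rf_z\<^sup>2 * to_fract b2)))
    = mult_op (to_fract b2 * rf_z\<^sup>2) * d_dz ^ 2 + mult_op (to_fract b1 * rf_z) * d_dz
      + mult_op (to_fract b0)"
    unfolding distrib_left mult.assoc[symmetric] mult_op_mult[symmetric] e(2) e(3) by (subst e(1)) rule
  also have "\<dots> = mult_op (to_fract b2) * (theta * (theta - 1)) + mult_op (to_fract b1) * theta
      + mult_op (to_fract b0)"
    by (simp only: mult_op_mult theta_square mult_op_power) (simp only: mult.assoc)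
  also have "\<dots> = (\<Sum>j\<le>n. zop ^ j * theta_poly (euler_coeff b2 b1 b0 j))"
  proof -
    have "theta_poly ([:0, 1:] * [:-1, 1:]) = theta * (theta - 1)"
      by (simp add: theta_poly_mult rf_const_uminus mult_op_uminus)
    then have "theta_poly (euler_coeff b2 b1 b0 j)
        = cop (coeff b2 j) * (theta * (theta - 1)) + cop (coeff b1 j) * theta + cop (coeff b0 j)" for j
      by (simp add: euler_coeff_def theta_poly_add theta_poly_smult del: smult_pCons)
    then show ?thesis
      by (simp only: mult_op_to_fract[OF assms(2)] mult_op_to_fract[OF assms(3)]
          mult_op_to_fract[OF assms(4)] sum_distrib_right sum.distrib distrib_left mult.assoc)
  qed
  finally show ?thesis .
qed

lemma zop_d_dz_theta_poly: "zop * (d_dz * theta_poly p) = theta_poly ([:0, 1:] * p)"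
  by (simp add: theta_poly_mult mult.assoc)

text \<open>Here \<open>E(\<theta>) = (\<theta> + e\<^sub>1) \<dots> (\<theta> + e\<^sub>N)\<close>; the factors \<open>\<theta> + e - 1\<close> and \<open>\<theta> + e + 1\<close> of the two products
  combine to \<open>E(\<theta> - 1)\<close> and \<open>E(\<theta> + 1)\<close>. An additional factor \<open>z\<close> turns \<open>d/dz\<close> into \<open>\<theta>\<close>.\<close>

lemma hypergeom_op_eq:
  fixes es :: "complex list"
  defines "E \<equiv> (\<Prod>e\<leftarrow>es. [:e, 1:])"
  shows "hypergeom_op (\<alpha> # \<beta> # map (\<lambda>e. e + 1) es) (\<gamma> # es)
    = mult_op (1 / (rf_z ^ (length es + 2) * (1 - rf_z))) *
      (theta_poly ([:0, 1:] * [:\<gamma> - 1, 1:] * pcompose E [:-1, 1:])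
        - zop * theta_poly ([:\<alpha>, 1:] * [:\<beta>, 1:] * shift_poly 1 E))"
proof -
  have sh: "pcompose E [:c, 1:] = (\<Prod>e\<leftarrow>es. [:e + c, 1:])" for c
  proof -
    have l: "pcompose [:a, 1:] [:c, 1:] = [:a + c, 1:]" for a
      by (simp add: pcompose_pCons mult_pCons_left)
    show ?thesis
      unfolding E_def by (induction es) (simp_all add: pcompose_mult l pcompose_1)
  qed
  have 1: "prod_list (map (\<lambda>b. euler_op (b - 1)) (\<gamma> # es))
      = theta_poly ([:\<gamma> - 1, 1:] * pcompose E [:-1, 1:])"
    unfolding sh
    by (simp add: theta_poly_mult theta_poly_prod_list euler_op_eq_theta_poly o_def
        del: theta_poly_pCons)
  have 2: "prod_list (map euler_op (\<alpha> # \<beta> # map (\<lambda>e. e + 1) es))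
      = theta_poly ([:\<alpha>, 1:] * [:\<beta>, 1:] * shift_poly 1 E)"
    unfolding sh
    by (simp add: theta_poly_mult theta_poly_prod_list euler_op_eq_theta_poly o_def mult.assoc
        del: theta_poly_pCons)
  have "1 / (rf_z ^ length (\<gamma> # es) * (1 - rf_z)) = 1 / (rf_z ^ (length es + 2) * (1 - rf_z)) * rf_z"
    by simp
  then show ?thesis
    unfolding hypergeom_op_def 1 2 by (simp only: mult_op_mult mult.assoc right_diff_distrib zop_d_dz_theta_poly)
qed

section \<open>Additivity of the order\<close>

lemma degree_ore_shift:
  assumes "q \<noteq> 0"
  shows "degree (ore_shift q) = Suc (degree q)" and "lead_coeff (ore_shift q) = lead_coeff q"
proof -
  have le: "degree (map_poly rf_deriv q) \<le> degree q"
    by (rule degree_le) (simp add: coeff_map_poly coeff_eq_0)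
  have "coeff (map_poly rf_deriv q) (Suc (degree q)) = 0"
    using le by (intro coeff_eq_0) simp
  then have c: "coeff (ore_shift q) (Suc (degree q)) = lead_coeff q"
    by (simp add: ore_shift_def)
  show "degree (ore_shift q) = Suc (degree q)"
  proof (rule antisym)
    show "degree (ore_shift q) \<le> Suc (degree q)"
      unfolding ore_shift_def using le by (intro degree_add_le degree_pCons_le) simp
    show "Suc (degree q) \<le> degree (ore_shift q)"
      using c assms by (intro le_degree) simp
  qed
  with c show "lead_coeff (ore_shift q) = lead_coeff q"
    by simp
qed

text \<open>The derivatives of the coefficients enter only in lower order, so leading terms multiply as for
  commutative polynomials.\<close>

lemma degree_ore_mult:
  assumes "p \<noteq> 0" and "q \<noteq> 0"
  shows "degree (ore_mult p q) = degree p + degree q \<and>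
    lead_coeff (ore_mult p q) = lead_coeff p * lead_coeff q"
  using assms
proof (induction p arbitrary: q)
  case (pCons a p)
  show ?case
  proof (cases "p = 0")
    case True
    with pCons show ?thesis
      by (simp add: ore_mult_pCons)
  next
    case False
    have "ore_shift q \<noteq> 0"
      using degree_ore_shift[OF pCons.prems(2)] by auto
    note IH = pCons.IH[OF False this, unfolded degree_ore_shift(2)[OF pCons.prems(2)]]
    then have d: "degree (ore_mult p (ore_shift q)) = degree p + Suc (degree q)"
      by (simp add: degree_ore_shift(1)[OF pCons.prems(2)])
    from IH have l: "lead_coeff (ore_mult p (ore_shift q)) = lead_coeff p * lead_coeff q"
      by blast
    have lt: "degree (smult a q) < degree (ore_mult p (ore_shift q))"
      unfolding d using degree_smult_le[of a q] by linarith
    have "lead_coeff (ore_mult (pCons a p) q) = lead_coeff p * lead_coeff q"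
      unfolding ore_mult_pCons using lt by (subst lead_coeff_add_le) (auto simp: l)
    then show ?thesis
      using lt d False by (simp add: ore_mult_pCons degree_add_eq_right)
  qed
qed simp

lemma diffop_order_mult:
  assumes "K \<noteq> 0" and "L \<noteq> 0"
  shows "diffop_order (K * L) = diffop_order K + diffop_order L"
  using assms degree_ore_mult[of "diffop_poly K" "diffop_poly L"]
  by (simp add: diffop_order_def times_diffop.rep_eq flip: diffop_poly_inject zero_diffop.rep_eq)

definition diffop_lead :: "diffop \<Rightarrow> ratfun" where
  "diffop_lead L = lead_coeff (diffop_poly L)"

lemma diffop_lead_mult: "diffop_lead (K * L) = diffop_lead K * diffop_lead L"
  using degree_ore_mult[of "diffop_poly K" "diffop_poly L"]
  by (cases "K = 0 \<or> L = 0")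
    (auto simp: diffop_lead_def times_diffop.rep_eq zero_diffop.rep_eq simp flip: diffop_poly_inject)

lemma diffop_poly_L:
  "diffop_poly (d_dz ^ 2 + mult_op f * d_dz + mult_op g) = [:g, f, 1:]"
proof -
  have "d_dz ^ 2 = Diffop [:0, 0, 1:]"
    by (simp add: power2_eq_square d_dz_def times_diffop.abs_eq eq_onp_def ore_mult_pCons ore_shift_pCons)
  moreover have "mult_op f * d_dz = Diffop [:0, f:]"
    by (simp add: mult_op_def d_dz_def times_diffop.abs_eq eq_onp_def ore_mult_pCons)
  ultimately show ?thesis
    by (simp add: mult_op_def plus_diffop.abs_eq eq_onp_def Diffop_inverse)
qed

lemma diffop_order_mult_op [simp]: "diffop_order (mult_op f) = 0"
  by (simp add: diffop_order_def mult_op_def Diffop_inverse)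

lemma mult_op_eq_0_iff [simp]: "mult_op f = 0 \<longleftrightarrow> f = 0"
  by (simp add: mult_op_def zero_diffop_def Diffop_inject)

lemma euler_prod_order:
  "diffop_order (prod_list (map euler_op cs)) = length cs
    \<and> diffop_lead (prod_list (map euler_op cs)) = rf_z ^ length cs"
proof (induction cs)
  case Nil
  show ?case
    by (simp add: diffop_order_def diffop_lead_def one_diffop.rep_eq)
next
  case (Cons c cs)
  define P where "P = prod_list (map euler_op cs)"
  have e: "diffop_poly (euler_op c) = [:rf_const c, rf_z:]"
    by (simp add: euler_op_def mult_op_def d_dz_def times_diffop.abs_eq plus_diffop.abs_eq eq_onp_def
        ore_mult_pCons Diffop_inverse)
  have "P \<noteq> 0"
    using Cons by (auto simp: P_def diffop_lead_def zero_diffop.rep_eq)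
  moreover have "euler_op c \<noteq> 0"
    using e by (auto simp: zero_diffop.rep_eq)
  ultimately show ?case
    using Cons by (simp add: diffop_order_mult diffop_lead_mult flip: P_def)
      (simp add: diffop_order_def diffop_lead_def e)
qed

lemma diffop_order_hypergeom_op:
  assumes "length as = Suc (length bs)"
  shows "diffop_order (hypergeom_op as bs) = Suc (length bs)"
proof -
  define P where "P = prod_list (map (\<lambda>b. euler_op (b - 1)) bs)"
  define Q where "Q = prod_list (map euler_op as)"
  have P: "diffop_order P = length bs" "diffop_lead P = rf_z ^ length bs"
    using euler_prod_order[of "map (\<lambda>b. b - 1) bs"] by (simp_all add: P_def o_def)
  have Q: "diffop_order Q = Suc (length bs)" "diffop_lead Q = rf_z ^ Suc (length bs)"
    using euler_prod_order[of as] by (simp_all add: Q_def assms)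
  have "P \<noteq> 0"
    using P by (auto simp: diffop_lead_def zero_diffop.rep_eq)
  moreover have d: "diffop_poly d_dz = [:0, 1:]"
    by (simp add: d_dz_def Diffop_inverse)
  moreover from d have "d_dz \<noteq> 0"
    by (auto simp: zero_diffop.rep_eq)
  ultimately have dP: "diffop_order (d_dz * P) = Suc (length bs)" "diffop_lead (d_dz * P) = rf_z ^ length bs"
    by (simp_all add: diffop_order_mult diffop_lead_mult P) (simp_all add: diffop_order_def diffop_lead_def)
  define R where "R = d_dz * P - Q"
  have "coeff (diffop_poly R) (Suc (length bs)) = rf_z ^ length bs - rf_z ^ Suc (length bs)"
    using dP Q by (simp add: R_def minus_diffop.rep_eq diffop_lead_def diffop_order_def)
  also have "\<dots> = rf_z ^ length bs * (1 - rf_z)"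
    by (simp add: algebra_simps)
  finally have "coeff (diffop_poly R) (Suc (length bs)) \<noteq> 0"
    by (simp add: eq_commute[of 1])
  moreover have "diffop_order R \<le> Suc (length bs)"
    using dP Q unfolding R_def diffop_order_def minus_diffop.rep_eq by (intro degree_diff_le) auto
  ultimately have "diffop_order R = Suc (length bs)" "R \<noteq> 0"
    by (auto simp: diffop_order_def zero_diffop.rep_eq intro!: antisym le_degree)
  then show ?thesis
    by (simp add: hypergeom_op_def diffop_order_mult eq_commute[of 1] flip: P_def Q_def R_def)
qed

section \<open>Remainders modulo a linear factor on the left\<close>

text \<open>If \<open>L = \<Sum>j\<le>n. z\<^sup>j q\<^sub>j(\<theta>)\<close>, then \<open>mellin_op n t q\<close> is what remains of \<open>G(\<theta>) L\<close>
  modulo operators divisible by \<open>z - t\<close> on the left.\<close>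

definition mellin_op :: "nat \<Rightarrow> complex \<Rightarrow> (nat \<Rightarrow> complex poly) \<Rightarrow> complex poly \<Rightarrow> complex poly" where
  "mellin_op n t q G = (\<Sum>j\<le>n. smult (t ^ j) (shift_poly j G * q j))"

lemma mellin_op_add: "mellin_op n t q (G + H) = mellin_op n t q G + mellin_op n t q H"
  by (simp add: mellin_op_def pcompose_add smult_add_right distrib_right sum.distrib)

lemma mellin_op_smult: "mellin_op n t q (smult c G) = smult c (mellin_op n t q G)"
  by (rule poly_eqI) (simp add: mellin_op_def pcompose_smult coeff_sum sum_distrib_left ac_simps)

text \<open>Taylor's formula to first order.\<close>

lemma coeff_shift_remainder:
  fixes G :: "complex poly"
  assumes "degree G \<le> d" and "d \<le> Suc i"
  shows "coeff (pcompose G [:a, 1:] - G - smult a (pderiv G)) i = 0"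
  using assms
proof (induction G arbitrary: d i)
  case (pCons c G)
  define R where "R = pcompose G [:a, 1:] - G - smult a (pderiv G)"
  have eq: "pcompose (pCons c G) [:a, 1:] - pCons c G - smult a (pderiv (pCons c G))
      = smult (a\<^sup>2) (pderiv G) + smult a R + pCons 0 R"
    unfolding poly_eq_poly_eq_iff[symmetric]
    by (simp add: fun_eq_iff R_def pcompose_pCons pderiv_pCons poly_pcompose algebra_simps power2_eq_square)
  show ?case
  proof (cases "G = 0")
    case True
    then show ?thesis
      by (simp add: pderiv_pCons)
  next
    case False
    then obtain e where e: "d = Suc e"
      using pCons.prems(1) by (cases d) auto
    with pCons.prems False have dG: "degree G \<le> e" and ei: "e \<le> i"
      by auto
    have 1: "coeff (pderiv G) i = 0"
      using dG ei by (simp add: coeff_pderiv coeff_eq_0)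
    have 2: "coeff R i = 0"
      unfolding R_def by (rule pCons.IH[OF dG]) (use ei in simp)
    have 3: "coeff (pCons 0 R) i = 0"
    proof (cases i)
      case (Suc i')
      then show ?thesis
        unfolding R_def using pCons.IH[OF dG, of i'] ei by simp
    qed simp
    show ?thesis
      unfolding eq by (simp add: 1 2 3)
  qed
qed simp

lemma mellin_op_diff: "mellin_op n t q (G - H) = mellin_op n t q G - mellin_op n t q H"
  using mellin_op_add[of n t q "G - H" H] by simp

lemma poly_as_sum:
  fixes p :: "complex poly"
  assumes "degree p \<le> n"
  shows "poly p t = (\<Sum>j\<le>n. coeff p j * t ^ j)"
  by (subst poly_as_sum_of_monoms'[OF assms, symmetric]) (simp add: poly_sum poly_monom)

lemma poly_pderiv_as_sum:
  fixes p :: "complex poly"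
  assumes "degree p \<le> n"
  shows "t * poly (pderiv p) t = (\<Sum>j\<le>n. coeff p j * (of_nat j * t ^ j))"
proof -
  have "t * poly (pderiv (monom c j)) t = c * (of_nat j * t ^ j)" for c j
    by (cases j) (simp_all add: pderiv_monom poly_monom)
  moreover have "pderiv (\<Sum>j\<in>A. f j) = (\<Sum>j\<in>A. pderiv (f j))" for f :: "nat \<Rightarrow> complex poly" and A
    by (induction A rule: infinite_finite_induct) (simp_all add: pderiv_add)
  ultimately show ?thesis
    by (subst poly_as_sum_of_monoms'[OF assms, symmetric])
      (simp add: poly_sum sum_distrib_left)
qed

lemma coeff_mult_eq_0:
  fixes p q :: "complex poly"
  assumes "\<And>i. d \<le> i \<Longrightarrow> coeff p i = 0" and "degree q \<le> e" and "d + e \<le> i"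
  shows "coeff (p * q) i = 0"
  unfolding coeff_mult
proof (intro sum.neutral ballI)
  fix j assume "j \<in> {..i}"
  then show "coeff p j * coeff q (i - j) = 0"
    using assms by (cases "d \<le> j") (auto intro!: coeff_eq_0)
qed

lemma degree_euler_coeff: "degree (euler_coeff b2 b1 b0 j) \<le> 2"
  by (rule degree_le) (auto simp: euler_coeff_def mult_pCons_left coeff_pCons split: nat.split)

text \<open>At a zero \<open>t\<close> of \<open>b2\<close> the leading parts of the summands cancel, so that the degree
  goes up by at most one. The new leading coefficient is, up to the factor \<open>t (d + 1)\<close>, the value of the
  indicial polynomial of \<open>t\<close> at \<open>d + 1\<close>.\<close>

lemma coeff_mellin_op:
  assumes G: "degree G \<le> d" and n: "degree b2 \<le> n" "degree b1 \<le> n" "degree b0 \<le> n"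
    and t: "poly b2 t = 0" and i: "Suc d \<le> i"
  shows "coeff (mellin_op n t (euler_coeff b2 b1 b0) G) i
    = (if i = Suc d then (poly b1 t + of_nat d * (t * poly (pderiv b2) t)) * coeff G d else 0)"
proof -
  define q where "q = euler_coeff b2 b1 b0"
  define R where "R j = pcompose G [:of_nat j, 1:] - G - smult (of_nat j) (pderiv G)" for j
  define S0 where "S0 = (\<Sum>j\<le>n. smult (t ^ j) (q j))"
  define S1 where "S1 = (\<Sum>j\<le>n. smult (of_nat j * t ^ j) (q j))"
  have "shift_poly j G = G + smult (of_nat j) (pderiv G) + R j" for j
    by (simp add: R_def)
  then have "smult (t ^ j) (shift_poly j G * q j)
      = smult (t ^ j) (q j) * G + smult (of_nat j * t ^ j) (q j) * pderiv G + smult (t ^ j) (R j * q j)" for j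
    by (simp add: algebra_simps smult_add_right)
  then have "mellin_op n t q G = S0 * G + S1 * pderiv G + (\<Sum>j\<le>n. smult (t ^ j) (R j * q j))"
    by (simp only: mellin_op_def S0_def S1_def sum.distrib sum_distrib_right)
  \<comment> \<open>\<open>R j\<close> has degree at most \<open>d - 2\<close>; for \<open>d < 2\<close> it is zero, which the truncated difference \<open>d - 1\<close>
    expresses only for \<open>d \<ge> 1\<close>.\<close>
  moreover have "coeff (R j * q j) i = 0" for j
  proof (cases "d = 0")
    case True
    have "R j = 0"
      unfolding R_def by (rule poly_eqI) (simp only: coeff_0, rule coeff_shift_remainder[OF G], simp add: True)
    then show ?thesis
      by simp
  next
    case False
    show ?thesis
    proof (rule coeff_mult_eq_0)
      show "coeff (R j) l = 0" if "d - 1 \<le> l" for l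
        unfolding R_def using that by (intro coeff_shift_remainder[OF G]) simp
      show "degree (q j) \<le> 2"
        unfolding q_def by (rule degree_euler_coeff)
      show "d - 1 + 2 \<le> i"
        using False i by simp
    qed
  qed
  moreover have "S0 = smult (poly b2 t) ([:0, 1:] * [:-1, 1:]) + smult (poly b1 t) [:0, 1:] + [:poly b0 t:]"
    unfolding S0_def q_def euler_coeff_def n[THEN poly_as_sum]
    by (rule poly_eqI) (simp add: coeff_sum sum_distrib_left sum_distrib_right sum.distrib coeff_pCons algebra_simps split: nat.split)
  moreover have "S1 = smult (t * poly (pderiv b2) t) ([:0, 1:] * [:-1, 1:])
      + smult (t * poly (pderiv b1) t) [:0, 1:] + [:t * poly (pderiv b0) t:]"
    unfolding S1_def q_def euler_coeff_def n[THEN poly_pderiv_as_sum]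
    by (rule poly_eqI) (simp add: coeff_sum sum_distrib_left sum_distrib_right sum.distrib coeff_pCons algebra_simps split: nat.split)
  ultimately show ?thesis
    using i G t unfolding q_def
    by (simp add: coeff_sum mult_pCons_left coeff_pCons coeff_pderiv coeff_eq_0 split: nat.split)
      (auto simp: algebra_simps)
qed

text \<open>Solve for the coefficients of \<open>G\<close> from the top down.\<close>

lemma exists_mellin_op_const:
  assumes n: "degree b2 \<le> n" "degree b1 \<le> n" "degree b0 \<le> n"
    and t: "poly b2 t = 0" "poly (pderiv b2) t \<noteq> 0" "t \<noteq> 0"
    and b1: "poly b1 t = - of_nat m * t * poly (pderiv b2) t"
  shows "\<exists>G c. degree G \<le> m \<and> coeff G m = 1 \<and> mellin_op n t (euler_coeff b2 b1 b0) G = [:c:]"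
proof -
  define q where "q = euler_coeff b2 b1 b0"
  define w where "w = t * poly (pderiv b2) t"
  have w: "w \<noteq> 0"
    using t by (simp add: w_def)
  have T: "coeff (mellin_op n t q G) i = (if i = Suc d then (of_nat d - of_nat m) * w * coeff G d else 0)"
    if "degree G \<le> d" "Suc d \<le> i" for G d i
    unfolding q_def coeff_mellin_op[OF that(1) n t(1) that(2)] b1 w_def by (simp add: algebra_simps)
  \<comment> \<open>In step \<open>k\<close> the coefficient of \<open>x ^ (m - k)\<close> in \<open>T G\<close> is removed by changing the coefficient of
    \<open>x ^ (m - k - 1)\<close> in \<open>G\<close>. The pivot is nonzero since \<open>m - k - 1 < m\<close>.\<close>
  have "\<exists>G. degree G \<le> m \<and> coeff G m = 1 \<and> (\<forall>i>m - k. coeff (mellin_op n t q G) i = 0)" if "k \<le> m" for k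
    using that
  proof (induction k)
    case 0
    have "coeff (mellin_op n t q (monom 1 m)) i = 0" if "m < i" for i
      using that T[of "monom 1 m" m i] by (simp add: degree_monom_eq)
    then show ?case
      by (intro exI[of _ "monom 1 m"]) (simp add: degree_monom_eq)
  next
    case (Suc k)
    then obtain G where G: "degree G \<le> m" "coeff G m = 1" "\<And>i. m - k < i \<Longrightarrow> coeff (mellin_op n t q G) i = 0"
      by auto
    define e where "e = m - Suc k"
    have e: "m - k = Suc e" "e < m"
      using Suc.prems by (auto simp: e_def)
    have p: "(of_nat e - of_nat m) * w \<noteq> 0"
      using w e(2) by simp
    define H where "H = G - smult (coeff (mellin_op n t q G) (Suc e) / ((of_nat e - of_nat m) * w)) (monom 1 e)"
    have "coeff (mellin_op n t q H) i = 0" if "e < i" for i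
      using that p G(3)[of i] T[of "monom 1 e" e i]
      by (auto simp: e H_def mellin_op_diff mellin_op_smult degree_monom_eq)
    moreover have "degree H \<le> m"
      unfolding H_def using G(1) e(2)
      by (intro degree_diff_le order.trans[OF degree_smult_le]) (auto simp: degree_monom_eq)
    moreover have "coeff H m = 1"
      using G(2) e(2) by (simp add: H_def)
    ultimately show ?case
      by (auto simp: e_def)
  qed
  from this[OF order.refl] obtain G where G: "degree G \<le> m" "coeff G m = 1"
    "\<And>i. 0 < i \<Longrightarrow> coeff (mellin_op n t q G) i = 0"
    by auto
  then have "mellin_op n t q G = [:coeff (mellin_op n t q G) 0:]"
    by (intro poly_eqI) (simp add: coeff_pCons split: nat.split)
  with G show ?thesis
    unfolding q_def by blast
qed

section \<open>Evaluation on solutions that are power series\<close>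

abbreviation fps_z :: "complex \<Rightarrow> complex fps" where
  "fps_z t \<equiv> fps_const t + fps_X"

definition theta_fps :: "complex \<Rightarrow> complex poly \<Rightarrow> complex fps \<Rightarrow> complex fps" where
  "theta_fps t p F = fold_coeffs (\<lambda>a H. fps_const a * F + fps_z t * fps_deriv H) p 0"

lemma theta_fps_0_left [simp]: "theta_fps t 0 F = 0"
  by (simp add: theta_fps_def)

lemma theta_fps_pCons [simp]:
  "theta_fps t (pCons a p) F = fps_const a * F + fps_z t * fps_deriv (theta_fps t p F)"
  by (cases "p = 0 \<and> a = 0") (auto simp: theta_fps_def)

lemma theta_fps_add_left: "theta_fps t (p + q) F = theta_fps t p F + theta_fps t q F"
  by (induction p q rule: poly_induct2) (simp_all add: algebra_simps flip: fps_const_add)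

lemma theta_fps_smult: "theta_fps t (smult c p) F = fps_const c * theta_fps t p F"
  by (induction p) (simp_all add: algebra_simps flip: fps_const_mult)

lemma theta_fps_mult: "theta_fps t (p * q) F = theta_fps t p (theta_fps t q F)"
  by (induction p) (simp_all add: mult_pCons_left theta_fps_add_left theta_fps_smult)

lemma theta_fps_sum_left: "theta_fps t (sum p A) F = (\<Sum>i\<in>A. theta_fps t (p i) F)"
  by (induction A rule: infinite_finite_induct) (simp_all add: theta_fps_add_left)

lemma theta_fps_add_right: "theta_fps t p (F + G) = theta_fps t p F + theta_fps t p G"
  by (induction p) (simp_all add: algebra_simps)

lemma theta_fps_0_right [simp]: "theta_fps t p 0 = 0"
  by (induction p) simp_all

lemma theta_fps_sum_right: "theta_fps t p (sum F A) = (\<Sum>i\<in>A. theta_fps t p (F i))"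
  by (induction A rule: infinite_finite_induct) (simp_all add: theta_fps_add_right)

lemma theta_fps_z: "theta_fps t p (fps_z t * F) = fps_z t * theta_fps t (shift_poly 1 p) F"
  by (induction p) (simp_all add: pcompose_pCons theta_fps_add_left theta_fps_mult algebra_simps)

lemma theta_fps_z_power:
  "theta_fps t p (fps_z t ^ j * F) = fps_z t ^ j * theta_fps t (shift_poly j p) F"
proof (induction j arbitrary: p)
  case (Suc j)
  have "theta_fps t p (fps_z t ^ Suc j * F) = fps_z t * theta_fps t (shift_poly 1 p) (fps_z t ^ j * F)"
    by (simp only: power_Suc mult.assoc theta_fps_z)
  also have "\<dots> = fps_z t ^ Suc j * theta_fps t (shift_poly (j + 1) p) F"
    by (simp only: Suc.IH shift_poly_shift_poly power_Suc mult.assoc)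
  finally show ?case
    by simp
qed simp

text \<open>Modulo operators divisible by \<open>z - t\<close> on the left, the operator \<open>G(\<theta>) L\<close> is \<open>(T G)(\<theta>)\<close>; hence its value at \<open>t\<close> on a
  solution of \<open>L F = 0\<close> is that of \<open>(T G)(\<theta>) F\<close>. Power series are expanded in \<open>z - t\<close>, so that \<open>z\<close>
  itself acts as \<open>t + X\<close>.\<close>

lemma theta_fps_mellin_op:
  assumes "(\<Sum>j\<le>n. fps_z t ^ j * theta_fps t (q j) F) = 0"
  shows "fps_nth (theta_fps t (mellin_op n t q G) F) 0 = 0"
proof -
  have "(\<Sum>j\<le>n. fps_z t ^ j * theta_fps t (shift_poly j G * q j) F) = theta_fps t G 0"
    unfolding assms[symmetric] theta_fps_sum_right theta_fps_z_power theta_fps_mult ..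
  from arg_cong[OF this, of "\<lambda>H. fps_nth H 0"] show ?thesis
    by (simp add: mellin_op_def theta_fps_sum_left theta_fps_smult fps_sum_nth fps_mult_nth_0
        fps_nth_power_0)
qed

abbreviation fps_poly_at :: "complex \<Rightarrow> complex poly \<Rightarrow> complex fps" where
  "fps_poly_at t p \<equiv> fps_of_poly (pcompose p [:t, 1:])"

lemma fps_poly_at_eq_sum:
  assumes "degree p \<le> n"
  shows "fps_poly_at t p = (\<Sum>j\<le>n. fps_const (coeff p j) * fps_z t ^ j)"
proof -
  have "pcompose (monom c j) [:t, 1:] = smult c ([:t, 1:] ^ j)" for c j
    by (induction j) (simp_all add: monom_0 monom_Suc pcompose_pCons)
  then have "fps_poly_at t p = (\<Sum>j\<le>n. fps_const (coeff p j) * fps_of_poly [:t, 1:] ^ j)"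
    by (subst poly_as_sum_of_monoms'[OF assms, symmetric])
      (simp add: pcompose_sum fps_of_poly_sum fps_of_poly_smult fps_of_poly_power)
  then show ?thesis
    by (simp add: fps_of_poly_pCons)
qed

lemma euler_form_fps:
  assumes "degree b2 \<le> n" "degree b1 \<le> n" "degree b0 \<le> n"
  shows "(\<Sum>j\<le>n. fps_z t ^ j * theta_fps t (euler_coeff b2 b1 b0 j) F)
    = fps_z t ^ 2 * fps_poly_at t b2 * fps_deriv (fps_deriv F)
      + fps_z t * fps_poly_at t b1 * fps_deriv F + fps_poly_at t b0 * F"
proof -
  have "theta_fps t ([:0, 1:] * [:-1, 1:]) F = fps_z t ^ 2 * fps_deriv (fps_deriv F)"
    by (simp add: theta_fps_mult power2_eq_square algebra_simps flip: fps_const_neg)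
  then have "theta_fps t (euler_coeff b2 b1 b0 j) F
      = fps_const (coeff b2 j) * (fps_z t ^ 2 * fps_deriv (fps_deriv F))
      + fps_const (coeff b1 j) * (fps_z t * fps_deriv F) + fps_const (coeff b0 j) * F" for j
    by (simp add: euler_coeff_def theta_fps_add_left theta_fps_smult del: smult_pCons)
  then show ?thesis
    by (simp add: assms[THEN fps_poly_at_eq_sum] sum_distrib_left sum_distrib_right sum.distrib algebra_simps)
qed

section \<open>Solutions near an ordinary point\<close>

fun recurrence_seq :: "complex \<Rightarrow> complex \<Rightarrow> (nat \<Rightarrow> nat \<Rightarrow> complex) \<Rightarrow> nat \<Rightarrow> complex" where
  "recurrence_seq a b K 0 = a"
| "recurrence_seq a b K (Suc 0) = b"
| "recurrence_seq a b K (Suc (Suc n)) = (\<Sum>k<Suc (Suc n). K n k * recurrence_seq a b K k)"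

text \<open>Geometric growth: if the earlier terms are bounded by \<open>C (B + 2)\<^sup>k\<close>, then the next one is bounded by
  \<open>B C \<Sum>k<n. (B + 2)\<^sup>k \<le> C (B + 2)\<^sup>n\<close>.\<close>

lemma recurrence_seq_bound:
  assumes K: "\<And>n k. k < Suc (Suc n) \<Longrightarrow> norm (K n k) \<le> B"
  shows "norm (recurrence_seq a b K n) \<le> (norm a + norm b) * (B + 2) ^ n"
proof (induction n rule: less_induct)
  case (less n)
  have B: "0 \<le> B"
    using K[of 0 0] norm_ge_zero[of "K 0 0"] by linarith
  define C where "C = norm a + norm b"
  have C: "0 \<le> C"
    by (simp add: C_def)
  consider "n = 0" | "n = 1" | i where "n = Suc (Suc i)"
    by (metis One_nat_def not0_implies_Suc)
  then show ?case
  proof cases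
    case 1
    then show ?thesis
      by simp
  next
    case 2
    have "norm b \<le> (norm a + norm b) * 1"
      by simp
    also have "\<dots> \<le> (norm a + norm b) * (B + 2)"
      using B by (intro mult_left_mono) auto
    finally show ?thesis
      by (simp add: 2)
  next
    case (3 i)
    have "norm (recurrence_seq a b K n) \<le> (\<Sum>k<n. norm (K i k * recurrence_seq a b K k))"
      unfolding 3 recurrence_seq.simps by (rule norm_sum)
    also have "\<dots> \<le> (\<Sum>k<n. B * (C * (B + 2) ^ k))"
      using less K[of _ i] B unfolding norm_mult C_def by (intro sum_mono mult_mono) (auto simp: 3)
    also have "\<dots> = B * C * (\<Sum>k<n. (B + 2) ^ k)"
      by (simp add: sum_distrib_left mult.assoc)
    also have "\<dots> = B * C * (((B + 2) ^ n - 1) / (B + 1))"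
      using B by (subst geometric_sum) auto
    also have "\<dots> \<le> C * (B + 2) ^ n"
    proof -
      have "B * (((B + 2) ^ n - 1) / (B + 1)) = (B / (B + 1)) * ((B + 2) ^ n - 1)"
        by simp
      also have "\<dots> \<le> 1 * (B + 2) ^ n"
        using B by (intro mult_mono) (auto simp: one_le_power)
      finally have "C * (B * (((B + 2) ^ n - 1) / (B + 1))) \<le> C * (1 * (B + 2) ^ n)"
        using C by (rule mult_left_mono)
      then show ?thesis
        by (simp only: mult_1 mult.assoc mult.left_commute[of C B])
    qed
    finally show ?thesis
      by (simp add: C_def)
  qed
qed

lemma coeff_norm_bound: "\<exists>B. \<forall>j. norm (coeff (p :: complex poly) j) \<le> B"
proof (intro exI allI)
  fix j
  show "norm (coeff p j) \<le> (\<Sum>i\<le>degree p. norm (coeff p i))"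
  proof (cases "j \<le> degree p")
    case True
    then show ?thesis
      by (intro member_le_sum) auto
  next
    case False
    then show ?thesis
      by (simp add: coeff_eq_0 sum_nonneg)
  qed
qed

text \<open>Comparing coefficients of \<open>X\<^sup>n\<close> expresses the coefficient of index \<open>n + 2\<close> by all earlier ones. The
  weights stay bounded because their growth in \<open>n\<close> is at most that of the divisor \<open>(n + 2) (n + 1)\<close>; so
  the radius of convergence is positive.\<close>

lemma ode_power_series_solution:
  assumes c2: "coeff c2 0 \<noteq> 0"
  obtains F :: "complex fps" where "fps_nth F 0 = a" "fps_nth F 1 = b" "fps_conv_radius F > 0"
    "fps_of_poly c2 * fps_deriv (fps_deriv F) + fps_of_poly c1 * fps_deriv F + fps_of_poly c0 * F = 0"
proof -
  obtain B2 B1 B0 where B: "\<And>j. norm (coeff c2 j) \<le> B2" "\<And>j. norm (coeff c1 j) \<le> B1"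
    "\<And>j. norm (coeff c0 j) \<le> B0"
    using coeff_norm_bound[of c2] coeff_norm_bound[of c1] coeff_norm_bound[of c0] by blast
  define g where "g n k = coeff c2 (n + 2 - k) * (of_nat k * (of_nat k - 1))
      + coeff c1 (n + 1 - k) * of_nat k + (if k \<le> n then coeff c0 (n - k) else 0)" for n k
  define w where "w n = coeff c2 0 * of_nat ((n + 2) * (n + 1))" for n :: nat
  have w: "w n \<noteq> 0" for n
    unfolding w_def mult_eq_0_iff of_nat_eq_0_iff using c2 by simp
  define K where "K n k = - g n k / w n" for n k
  define f where "f = recurrence_seq a b K"
  define F where "F = Abs_fps f"
  have bound: "norm (K n k) \<le> (B2 + B1 + B0) / norm (coeff c2 0)" if "k < Suc (Suc n)" for n k
  proof -
    define q where "q = real ((n + 2) * (n + 1))"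
    have q: "q > 0" "1 \<le> q" "real k \<le> q"
      using that by (auto simp: q_def simp del: of_nat_mult of_nat_add)
    have "norm (of_nat k * (of_nat k - 1) :: complex) \<le> q"
    proof (cases k)
      case (Suc i)
      have "k * i \<le> (n + 2) * (n + 1)"
        using that Suc by (intro mult_le_mono) auto
      then have "real (k * i) \<le> q"
        unfolding q_def by (rule of_nat_mono)
      moreover have "of_nat k - 1 = (of_nat i :: complex)"
        by (simp add: Suc)
      ultimately show ?thesis
        by (simp only: norm_mult norm_of_nat of_nat_mult)
    qed (use q in simp)
    then have "norm (coeff c2 (n + 2 - k) * (of_nat k * (of_nat k - 1))) \<le> B2 * q"
      unfolding norm_mult[of "coeff c2 (n + 2 - k)"] using B(1) order.trans[OF norm_ge_zero B(1)] by (intro mult_mono) auto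
    moreover have "norm (coeff c1 (n + 1 - k) * of_nat k) \<le> B1 * q"
      unfolding norm_mult norm_of_nat using B(2) order.trans[OF norm_ge_zero B(2)] q by (intro mult_mono) auto
    moreover have "norm (if k \<le> n then coeff c0 (n - k) else 0) \<le> B0 * q"
    proof -
      have "norm (if k \<le> n then coeff c0 (n - k) else 0) \<le> B0 * 1"
        using B(3) order.trans[OF norm_ge_zero B(3)] by auto
      also have "\<dots> \<le> B0 * q"
        using q order.trans[OF norm_ge_zero B(3)] by (intro mult_left_mono) auto
      finally show ?thesis .
    qed
    ultimately have "norm (g n k) \<le> (B2 + B1 + B0) * q"
      unfolding g_def distrib_right by (intro norm_add_rule_thm order.trans[OF norm_triangle_ineq] add_mono)
    moreover have "norm (w n) = norm (coeff c2 0) * q"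
      by (simp only: w_def norm_mult[of "coeff c2 0"] norm_of_nat q_def)
    ultimately show ?thesis
      using q c2 by (simp add: K_def norm_divide divide_simps mult_ac)
  qed
  define R where "R = (B2 + B1 + B0) / norm (coeff c2 0) + 2"
  have R: "R > 0"
    using order.trans[OF norm_ge_zero B(1)] order.trans[OF norm_ge_zero B(2)] order.trans[OF norm_ge_zero B(3)]
    by (auto simp: R_def intro!: add_nonneg_pos divide_nonneg_nonneg)
  have "summable (\<lambda>n. f n * complex_of_real (1 / (2 * R)) ^ n)"
  proof (rule summable_comparison_test')
    show "summable (\<lambda>n. (norm a + norm b) * (1 / 2) ^ n)"
      by (intro summable_mult summable_geometric) simp
    show "norm (f n * complex_of_real (1 / (2 * R)) ^ n) \<le> (norm a + norm b) * (1 / 2) ^ n" for n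
    proof -
      have "norm (f n * complex_of_real (1 / (2 * R)) ^ n) = norm (f n) * (1 / (2 * R)) ^ n"
        using R by (simp add: norm_mult norm_power norm_divide)
      also have "\<dots> \<le> ((norm a + norm b) * R ^ n) * (1 / (2 * R)) ^ n"
      proof (rule mult_right_mono)
        show "norm (f n) \<le> (norm a + norm b) * R ^ n"
          unfolding f_def R_def by (rule recurrence_seq_bound[where K = K, OF bound])
        show "0 \<le> (1 / (2 * R)) ^ n"
          using R by simp
      qed
      also have "\<dots> = (norm a + norm b) * (1 / 2) ^ n"
        using R by (simp add: mult.assoc flip: power_mult_distrib)
      finally show ?thesis .
    qed
  qed
  then have "conv_radius f \<ge> norm (complex_of_real (1 / (2 * R)))"
    by (rule conv_radius_geI)
  moreover have "norm (complex_of_real (1 / (2 * R))) > 0"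
    using R by simp
  ultimately have "fps_conv_radius F > 0"
    unfolding fps_conv_radius_def F_def
    by (metis (no_types, lifting) ereal_less(2) fps_nth_Abs_fps ext less_le_trans)
  moreover have "fps_nth F 0 = a" "fps_nth F 1 = b"
    by (simp_all add: F_def f_def)
  moreover have "fps_of_poly c2 * fps_deriv (fps_deriv F) + fps_of_poly c1 * fps_deriv F + fps_of_poly c0 * F = 0"
  proof (rule fps_ext)
    fix n
    have "fps_nth (fps_of_poly c2 * fps_deriv (fps_deriv F)) n
        = (\<Sum>i<Suc n. coeff c2 (n - i) * (of_nat (Suc i) * of_nat (Suc (Suc i)) * f (Suc (Suc i))))"
      unfolding mult.commute[of "fps_of_poly _"] fps_mult_nth
      by (simp add: F_def atLeast0AtMost lessThan_Suc_atMost mult_ac del: of_nat_Suc)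
    also have "\<dots> = (\<Sum>k<Suc (Suc (Suc n)). coeff c2 (n + 2 - k) * (of_nat k * (of_nat k - 1)) * f k)"
      unfolding sum.lessThan_Suc_shift[of _ "Suc (Suc n)"] sum.lessThan_Suc_shift[of _ "Suc n"]
      by (simp add: mult_ac)
    finally have 2: "fps_nth (fps_of_poly c2 * fps_deriv (fps_deriv F)) n
        = (\<Sum>k<Suc (Suc n). coeff c2 (n + 2 - k) * (of_nat k * (of_nat k - 1)) * f k) + w n * f (Suc (Suc n))"
      by (simp add: w_def algebra_simps)
    have "fps_nth (fps_of_poly c1 * fps_deriv F) n
        = (\<Sum>i<Suc n. coeff c1 (n - i) * (of_nat (Suc i) * f (Suc i)))"
      unfolding mult.commute[of "fps_of_poly _"] fps_mult_nth
      by (simp add: F_def atLeast0AtMost lessThan_Suc_atMost mult_ac del: of_nat_Suc)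
    also have "\<dots> = (\<Sum>k<Suc (Suc n). coeff c1 (n + 1 - k) * of_nat k * f k)"
      unfolding sum.lessThan_Suc_shift[of _ "Suc n"] by (simp add: mult_ac)
    finally have 1: "fps_nth (fps_of_poly c1 * fps_deriv F) n
        = (\<Sum>k<Suc (Suc n). coeff c1 (n + 1 - k) * of_nat k * f k)" .
    have "fps_nth (fps_of_poly c0 * F) n = (\<Sum>k<Suc n. coeff c0 (n - k) * f k)"
      unfolding mult.commute[of "fps_of_poly _"] fps_mult_nth
      by (simp add: F_def atLeast0AtMost lessThan_Suc_atMost mult_ac)
    also have "\<dots> = (\<Sum>k<Suc (Suc n). (if k \<le> n then coeff c0 (n - k) else 0) * f k)"
      by simp
    finally have 0: "fps_nth (fps_of_poly c0 * F) n
        = (\<Sum>k<Suc (Suc n). (if k \<le> n then coeff c0 (n - k) else 0) * f k)" .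
    have "(\<Sum>k<Suc (Suc n). g n k * f k) + w n * f (Suc (Suc n)) = 0"
    proof -
      have "w n * f (Suc (Suc n)) = (\<Sum>k<Suc (Suc n). w n * (K n k * f k))"
        unfolding f_def recurrence_seq.simps sum_distrib_left ..
      also have "\<dots> = (\<Sum>k<Suc (Suc n). - (g n k * f k))"
        using w[of n] by (intro sum.cong refl) (simp add: K_def)
      finally show ?thesis
        by (simp only: sum_negf add.right_inverse)
    qed
    then show "fps_nth (fps_of_poly c2 * fps_deriv (fps_deriv F) + fps_of_poly c1 * fps_deriv F
        + fps_of_poly c0 * F) n = fps_nth 0 n"
      unfolding fps_add_nth 0 1 2 g_def distrib_right sum.distrib by (simp only: fps_zero_nth ac_simps)
  qed
  ultimately show ?thesis
    by (intro that[of F])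
qed

lemma has_fps_expansion_poly: "(\<lambda>w. poly p w) has_fps_expansion fps_of_poly p"
proof -
  have "eval_fps (fps_of_poly p) has_fps_expansion fps_of_poly p"
    by (rule eval_fps_has_fps_expansion) simp
  then show ?thesis
    by (simp add: eval_fps_of_poly[abs_def])
qed

lemma deriv_shift: "deriv (\<lambda>z. f (c + z)) = (\<lambda>z. deriv f (c + z :: complex))"
  using DERIV_shift[of f _ _ c] by (simp add: deriv_def fun_eq_iff add.commute)

lemma has_fps_expansion_ode:
  assumes "(\<lambda>w. y (c + w)) has_fps_expansion F"
  shows "(\<lambda>w. poly c2 (c + w) * deriv (deriv y) (c + w) + poly c1 (c + w) * deriv y (c + w)
      + poly c0 (c + w) * y (c + w)) has_fps_expansion
    fps_poly_at c c2 * fps_deriv (fps_deriv F) + fps_poly_at c c1 * fps_deriv F + fps_poly_at c c0 * F"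
proof -
  have p: "(\<lambda>w. poly p (c + w)) has_fps_expansion fps_poly_at c p" for p
    using has_fps_expansion_poly[of "pcompose p [:c, 1:]"] by (simp add: poly_pcompose)
  have 1: "(\<lambda>w. deriv y (c + w)) has_fps_expansion fps_deriv F"
    using has_fps_expansion_deriv[OF assms] by (simp add: deriv_shift)
  have 2: "(\<lambda>w. deriv (deriv y) (c + w)) has_fps_expansion fps_deriv (fps_deriv F)"
    using has_fps_expansion_deriv[OF 1] by (simp add: deriv_shift)
  show ?thesis
    by (intro has_fps_expansion_add has_fps_expansion_mult p 1 2 assms)
qed

lemma local_solution_exists:
  fixes c2 c1 c0 :: "complex poly"
  assumes "poly c2 z0 \<noteq> 0"
  obtains y \<rho> where "\<rho> > 0" "y holomorphic_on ball z0 \<rho>" "y z0 = a" "deriv y z0 = b"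
    "\<And>z. z \<in> ball z0 \<rho> \<Longrightarrow> poly c2 z * deriv (deriv y) z + poly c1 z * deriv y z + poly c0 z * y z = 0"
proof -
  have "coeff (pcompose c2 [:z0, 1:]) 0 \<noteq> 0"
    using assms by (simp add: poly_pcompose flip: poly_0_coeff_0)
  then obtain F :: "complex fps" where F: "fps_nth F 0 = a" "fps_nth F 1 = b" "fps_conv_radius F > 0"
    and ode: "fps_poly_at z0 c2 * fps_deriv (fps_deriv F) + fps_poly_at z0 c1 * fps_deriv F
      + fps_poly_at z0 c0 * F = 0"
    by (rule ode_power_series_solution)
  define y where "y z = eval_fps F (z - z0)" for z
  have y: "(\<lambda>w. y (z0 + w)) has_fps_expansion F"
    using eval_fps_has_fps_expansion[OF F(3)] by (simp add: y_def)
  then have "(\<lambda>w. deriv y (z0 + w)) has_fps_expansion fps_deriv F"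
    using has_fps_expansion_deriv by (fastforce simp: deriv_shift)
  then have y01: "y z0 = a" "deriv y z0 = b"
    using y F by (auto dest!: has_fps_expansion_imp_0_eq_fps_nth_0)
  from has_fps_expansion_ode[OF y, of c2 c1 c0]
  have "\<forall>\<^sub>F w in nhds 0. poly c2 (z0 + w) * deriv (deriv y) (z0 + w) + poly c1 (z0 + w) * deriv y (z0 + w)
      + poly c0 (z0 + w) * y (z0 + w) = 0"
    unfolding ode has_fps_expansion_0_iff .
  then obtain \<rho>1 where r1: "\<rho>1 > 0" "\<And>w. dist w 0 < \<rho>1 \<Longrightarrow> poly c2 (z0 + w) * deriv (deriv y) (z0 + w)
      + poly c1 (z0 + w) * deriv y (z0 + w) + poly c0 (z0 + w) * y (z0 + w) = 0"
    unfolding eventually_nhds_metric by blast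
  obtain S where S: "open S" "0 \<in> S" "(\<lambda>w. y (z0 + w)) holomorphic_on S"
    using has_fps_expansion_imp_holomorphic[OF y] by blast
  then obtain \<rho>2 where r2: "\<rho>2 > 0" "ball 0 \<rho>2 \<subseteq> S"
    by (meson openE)
  define \<rho> where "\<rho> = min \<rho>1 \<rho>2"
  have "(\<lambda>w. y (z0 + w)) \<circ> (\<lambda>z. z - z0) holomorphic_on ball z0 \<rho>"
  proof (rule holomorphic_on_compose_gen)
    show "(\<lambda>w. y (z0 + w)) holomorphic_on ball 0 \<rho>2"
      using S(3) r2(2) by (rule holomorphic_on_subset)
    show "(\<lambda>z. z - z0) ` ball z0 \<rho> \<subseteq> ball 0 \<rho>2"
      by (auto simp: \<rho>_def dist_norm norm_minus_commute)
  qed (intro holomorphic_intros)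
  then have "y holomorphic_on ball z0 \<rho>"
    by (simp add: o_def)
  moreover have "poly c2 z * deriv (deriv y) z + poly c1 z * deriv y z + poly c0 z * y z = 0"
    if "z \<in> ball z0 \<rho>" for z
    using r1(2)[of "z - z0"] that by (simp add: \<rho>_def dist_norm norm_minus_commute)
  ultimately show ?thesis
    using that[of \<rho> y] y01 r1(1) r2(1) by (simp add: \<rho>_def)
qed

section \<open>Exponents at a regular singular point\<close>

text \<open>For \<open>F = f X\<^sup>e\<^sup>+\<^sup>1 + \<dots>\<close> the coefficient of \<open>X\<^sup>e\<close> in the equation is \<open>p (e + 1) f (e - m)\<close>. Hence a
  nonzero solution without constant term begins with \<open>X\<^sup>m\<^sup>+\<^sup>1\<close>.\<close>

lemma fps_exponents:
  fixes A B C F :: "complex fps"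
  assumes A: "fps_nth A 0 = 0" "fps_nth A 1 = p" "p \<noteq> 0" and B: "fps_nth B 0 = - of_nat m * p"
    and ode: "A * fps_deriv (fps_deriv F) + B * fps_deriv F + C * F = 0"
    and F: "fps_nth F 0 = 0" "fps_nth F (Suc m) = 0"
  shows "F = 0"
proof (rule ccontr)
  assume "F \<noteq> 0"
  define e where "e = subdegree F - 1"
  have "subdegree F \<noteq> 0"
    using \<open>F \<noteq> 0\<close> F(1) by (metis nth_subdegree_nonzero)
  then have e: "subdegree F = Suc e"
    by (simp add: e_def)
  have low: "fps_nth F i = 0" if "i \<le> e" for i
    using that e by (intro nth_less_subdegree_zero) simp
  have lead: "fps_nth F (Suc e) \<noteq> 0"
    using nth_subdegree_nonzero[OF \<open>F \<noteq> 0\<close>] by (simp add: e)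
  have "fps_nth (A * fps_deriv (fps_deriv F)) e
      = (\<Sum>i=0..e. if i = 1 then p * (of_nat e * of_nat (Suc e) * fps_nth F (Suc e)) else 0)"
    unfolding fps_mult_nth
  proof (intro sum.cong refl)
    fix i assume i: "i \<in> {0..e}"
    consider "i = 0" | "i = 1" | "2 \<le> i"
      by linarith
    then show "fps_nth A i * fps_nth (fps_deriv (fps_deriv F)) (e - i)
        = (if i = 1 then p * (of_nat e * of_nat (Suc e) * fps_nth F (Suc e)) else 0)"
    proof cases
      case 2
      with i obtain e' where "e = Suc e'"
        by (cases e) auto
      with 2 A show ?thesis
        by (simp add: mult_ac)
    next
      case 3
      then show ?thesis
        using i low[of "Suc (Suc (e - i))"] by simp
    qed (use A in simp)
  qed
  also have "\<dots> = p * (of_nat e * of_nat (Suc e) * fps_nth F (Suc e))"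
    by (cases e) auto
  finally have 2: "fps_nth (A * fps_deriv (fps_deriv F)) e = p * (of_nat e * of_nat (Suc e) * fps_nth F (Suc e))" .
  have "fps_nth (B * fps_deriv F) e
      = (\<Sum>i=0..e. if i = 0 then - of_nat m * p * (of_nat (Suc e) * fps_nth F (Suc e)) else 0)"
    unfolding fps_mult_nth by (intro sum.cong refl) (auto simp: B low)
  then have 1: "fps_nth (B * fps_deriv F) e = - of_nat m * p * (of_nat (Suc e) * fps_nth F (Suc e))"
    by simp
  have 0: "fps_nth (C * F) e = 0"
    unfolding fps_mult_nth by (intro sum.neutral ballI) (simp add: low)
  have "p * of_nat (Suc e) * fps_nth F (Suc e) * (of_nat e - of_nat m) = 0"
    using arg_cong[OF ode, of "\<lambda>H. fps_nth H e"] by (simp only: fps_add_nth 0 1 2) (simp add: algebra_simps)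
  then have "e = m"
    using lead A(3) by (simp del: of_nat_Suc)
  with lead F(2) show False
    by simp
qed

section \<open>Apparent singularities\<close>

lemma rf_eval_divide:
  assumes "poly q z \<noteq> 0"
  shows "rf_eval (to_fract p / to_fract q) z = poly p z / poly q z"
proof -
  have q: "q \<noteq> 0"
    using assms by auto
  obtain a b where ab: "quot_of_fract (to_fract p / to_fract q) = (a, b)"
    by fastforce
  have "Fract a b = to_fract p / to_fract q" "b \<noteq> 0" "coprime a b"
    using Fract_quot_of_fract[of "to_fract p / to_fract q"] ab
      snd_quot_of_fract_nonzero[of "to_fract p / to_fract q"]
      coprime_quot_of_fract[of "to_fract p / to_fract q"] by auto
  then have eq: "a * q = p * b"
    using q by (simp add: to_fract_def eq_fract)
  then have "b dvd q"
    using \<open>coprime a b\<close> by (metis coprime_commute coprime_dvd_mult_right_iff dvd_triv_right)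
  then have "poly b z \<noteq> 0"
    using assms by auto
  moreover have "poly a z * poly q z = poly p z * poly b z"
    using arg_cong[OF eq, of "\<lambda>r. poly r z"] by simp
  ultimately show ?thesis
    using assms by (simp add: rf_eval_def ab field_simps)
qed

lemma solves_on_iff:
  fixes c2 c1 c0 :: "complex poly"
  assumes "\<And>z. z \<in> U \<Longrightarrow> poly c2 z \<noteq> 0"
  shows "solves_on (d_dz ^ 2 + mult_op (to_fract c1 / to_fract c2) * d_dz + mult_op (to_fract c0 / to_fract c2)) U y
    \<longleftrightarrow> y holomorphic_on U \<and>
      (\<forall>z\<in>U. poly c2 z * deriv (deriv y) z + poly c1 z * deriv y z + poly c0 z * y z = 0)"
proof -
  have one: "rf_eval 1 z = 1" for z
    using rf_eval_divide[of 1 z 1] by simp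
  have "(\<Sum>i\<le>2. rf_eval (coeff [:to_fract c0 / to_fract c2, to_fract c1 / to_fract c2, 1:] i) z * (deriv ^^ i) y z) = 0
      \<longleftrightarrow> poly c2 z * deriv (deriv y) z + poly c1 z * deriv y z + poly c0 z * y z = 0" if "z \<in> U" for z
    using assms[OF that] by (simp add: numeral_2_eq_2 rf_eval_divide one field_simps)
  moreover have "degree [:g, f, 1 :: ratfun:] = 2" for f g
    by simp
  ultimately show ?thesis
    unfolding solves_on_def diffop_order_def diffop_coeff_def diffop_poly_L by (simp only: cong: ball_cong)
qed

text \<open>Near \<open>z0\<close> the initial value problem has a local solution. Being a branch of a solution in the
  punctured disc, it extends to the whole disc, and so does the differential equation by analytic
  continuation.\<close>

lemma apparent_solution_extends:
  fixes c2 c1 c0 :: "complex poly"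
  assumes r: "0 < r" "\<And>U y. open U \<Longrightarrow> connected U \<Longrightarrow> U \<noteq> {} \<Longrightarrow> U \<subseteq> ball t r - {t} \<Longrightarrow>
      solves_on (d_dz ^ 2 + mult_op (to_fract c1 / to_fract c2) * d_dz + mult_op (to_fract c0 / to_fract c2)) U y
      \<Longrightarrow> \<exists>Y. Y holomorphic_on ball t r \<and> (\<forall>z\<in>U. Y z = y z)"
    and r': "0 < r'" "r' \<le> r" "\<And>z. z \<in> ball t r' - {t} \<Longrightarrow> poly c2 z \<noteq> 0"
    and z0: "z0 \<in> ball t r' - {t}"
  obtains Y F where "Y holomorphic_on ball t r" "Y z0 = a" "deriv Y z0 = b"
    "(\<lambda>w. Y (t + w)) has_fps_expansion F"
    "fps_poly_at t c2 * fps_deriv (fps_deriv F) + fps_poly_at t c1 * fps_deriv F + fps_poly_at t c0 * F = 0"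
proof -
  obtain y \<rho> where y: "\<rho> > 0" "y holomorphic_on ball z0 \<rho>" "y z0 = a" "deriv y z0 = b"
    and ode: "\<And>z. z \<in> ball z0 \<rho> \<Longrightarrow> poly c2 z * deriv (deriv y) z + poly c1 z * deriv y z + poly c0 z * y z = 0"
    by (rule local_solution_exists[OF r'(3)[OF z0], of a b c1 c0]) (rule that)
  have "open (ball t r' - {t})"
    by (simp add: open_Diff)
  then obtain \<epsilon> where eps: "\<epsilon> > 0" "ball z0 \<epsilon> \<subseteq> ball t r' - {t}"
    using z0 by (meson openE)
  define U where "U = ball z0 (min \<rho> \<epsilon>)"
  have U: "open U" "connected U" "z0 \<in> U" "U \<subseteq> ball z0 \<rho>" "U \<subseteq> ball t r' - {t}"
    using y(1) eps by (auto simp: U_def)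
  have "solves_on (d_dz ^ 2 + mult_op (to_fract c1 / to_fract c2) * d_dz + mult_op (to_fract c0 / to_fract c2)) U y"
    using U r'(3) ode holomorphic_on_subset[OF y(2)] by (subst solves_on_iff) blast+
  moreover have "U \<subseteq> ball t r - {t}"
    using U(5) r'(2) by auto
  ultimately obtain Y where Y: "Y holomorphic_on ball t r" "\<And>z. z \<in> U \<Longrightarrow> Y z = y z"
    using r(2)[of U y] U by blast
  have d1: "deriv Y z = deriv y z" if "z \<in> U" for z
    using eventually_nhds_in_open[OF U(1) that] by (intro deriv_cong_ev) (auto elim: eventually_mono simp: Y)
  have d2: "deriv (deriv Y) z = deriv (deriv y) z" if "z \<in> U" for z
    using eventually_nhds_in_open[OF U(1) that] by (intro deriv_cong_ev) (auto elim: eventually_mono simp: d1)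
  define h where "h z = poly c2 z * deriv (deriv Y) z + poly c1 z * deriv Y z + poly c0 z * Y z" for z
  have "h holomorphic_on ball t r"
    unfolding h_def by (intro holomorphic_intros holomorphic_deriv Y) auto
  moreover have "h z = 0" if "z \<in> U" for z
    using ode[of z] U(4) that by (auto simp: h_def Y d1 d2)
  ultimately have h: "h z = 0" if "z \<in> ball t r" for z
    using analytic_continuation_open[of U "ball t r" h "\<lambda>_. 0" z] U \<open>U \<subseteq> ball t r - {t}\<close> that by auto
  have "Y analytic_on {t}"
    using Y(1) r(1) by (auto simp: analytic_at intro: exI[of _ "ball t r"])
  then have F: "(\<lambda>w. Y (t + w)) has_fps_expansion fps_expansion Y t"
    by (rule analytic_at_imp_has_fps_expansion)
  have "eventually (\<lambda>w. w \<in> ball 0 r) (nhds (0 :: complex))"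
    using r(1) by (intro eventually_nhds_in_open) auto
  then have "eventually (\<lambda>w. h (t + w) = 0) (nhds 0)"
    by (rule eventually_mono) (simp add: h dist_norm)
  then have "(\<lambda>w. h (t + w)) has_fps_expansion 0"
    by (simp add: has_fps_expansion_0_iff)
  with has_fps_expansion_ode[OF F, of c2 c1 c0]
  have odeF: "fps_poly_at t c2 * fps_deriv (fps_deriv (fps_expansion Y t)) + fps_poly_at t c1 * fps_deriv (fps_expansion Y t)
      + fps_poly_at t c0 * fps_expansion Y t = 0"
    unfolding h_def by (rule fps_expansion_unique_complex)
  have "Y z0 = a" "deriv Y z0 = b"
    using Y(2)[OF U(3)] d1[OF U(3)] y(3,4) by simp_all
  then show ?thesis
    by (rule that[OF Y(1) _ _ F odeF])
qed

text \<open>Two independent solutions both vanishing at \<open>t\<close> would have a nontrivial combination whose coefficient of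
  index \<open>m + 1\<close> vanishes too; by \<open>fps_exponents\<close> it would be zero.\<close>

lemma apparent_nonvanishing_solution:
  fixes c2 c1 c0 :: "complex poly"
  assumes app: "apparent_at (d_dz ^ 2 + mult_op (to_fract c1 / to_fract c2) * d_dz + mult_op (to_fract c0 / to_fract c2)) t"
    and c2: "poly c2 t = 0" "poly (pderiv c2) t \<noteq> 0"
    and c1: "poly c1 t = - of_nat m * poly (pderiv c2) t"
  shows "\<exists>F. fps_nth F 0 \<noteq> 0 \<and>
    fps_poly_at t c2 * fps_deriv (fps_deriv F) + fps_poly_at t c1 * fps_deriv F + fps_poly_at t c0 * F = 0"
proof (rule ccontr)
  assume contr: "\<not> ?thesis"
  define L where "L = d_dz ^ 2 + mult_op (to_fract c1 / to_fract c2) * d_dz + mult_op (to_fract c0 / to_fract c2)"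
  obtain r where r: "0 < r" and sol: "\<And>U y. open U \<Longrightarrow> connected U \<Longrightarrow> U \<noteq> {} \<Longrightarrow> U \<subseteq> ball t r - {t} \<Longrightarrow>
      solves_on L U y \<Longrightarrow> \<exists>Y. Y holomorphic_on ball t r \<and> (\<forall>z\<in>U. Y z = y z)"
    using app unfolding apparent_at_def L_def[symmetric] by auto
  have "c2 \<noteq> 0"
    using c2(2) by auto
  then have "finite {z. poly c2 z = 0}"
    by (rule poly_roots_finite)
  then obtain d where d: "d > 0" "\<And>z. poly c2 z = 0 \<Longrightarrow> z \<noteq> t \<Longrightarrow> d \<le> dist t z"
    using finite_set_avoid[of "{z. poly c2 z = 0}" t] by blast
  define r' where "r' = min r d"
  have r': "0 < r'" "r' \<le> r" "\<And>z. z \<in> ball t r' - {t} \<Longrightarrow> poly c2 z \<noteq> 0"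
    using r d by (force simp: r'_def)+
  define z0 where "z0 = t + of_real (r' / 2)"
  have z0: "z0 \<in> ball t r' - {t}"
    using r'(1) by (simp add: z0_def dist_norm)
  note ext = apparent_solution_extends[OF r sol[unfolded L_def] r' z0]
  have van: "fps_nth F 0 = 0"
    if "fps_poly_at t c2 * fps_deriv (fps_deriv F) + fps_poly_at t c1 * fps_deriv F + fps_poly_at t c0 * F = 0" for F
  proof (rule ccontr)
    assume "fps_nth F 0 \<noteq> 0"
    with that have "\<exists>F. fps_nth F 0 \<noteq> 0 \<and>
      fps_poly_at t c2 * fps_deriv (fps_deriv F) + fps_poly_at t c1 * fps_deriv F + fps_poly_at t c0 * F = 0"
      by (intro exI[of _ F] conjI)
    with contr show False
      by (rule notE)
  qed
  obtain Y1 F1 where 1: "Y1 holomorphic_on ball t r" "Y1 z0 = 1" "deriv Y1 z0 = 0"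
    "(\<lambda>w. Y1 (t + w)) has_fps_expansion F1"
    "fps_poly_at t c2 * fps_deriv (fps_deriv F1) + fps_poly_at t c1 * fps_deriv F1 + fps_poly_at t c0 * F1 = 0"
    by (rule ext[where a = 1 and b = 0])
  obtain Y2 F2 where 2: "Y2 holomorphic_on ball t r" "Y2 z0 = 0" "deriv Y2 z0 = 1"
    "(\<lambda>w. Y2 (t + w)) has_fps_expansion F2"
    "fps_poly_at t c2 * fps_deriv (fps_deriv F2) + fps_poly_at t c1 * fps_deriv F2 + fps_poly_at t c0 * F2 = 0"
    by (rule ext[where a = 0 and b = 1])
  obtain x1 x2 :: complex where x: "(x1, x2) \<noteq> (0, 0)" "x1 * fps_nth F1 (Suc m) + x2 * fps_nth F2 (Suc m) = 0"
  proof (cases "fps_nth F1 (Suc m) = 0")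
    case True
    then show ?thesis
      using that[of 1 0] by simp
  next
    case False
    then show ?thesis
      using that[of "- fps_nth F2 (Suc m)" "fps_nth F1 (Suc m)"] by simp
  qed
  define F where "F = fps_const x1 * F1 + fps_const x2 * F2"
  define Y where "Y z = x1 * Y1 z + x2 * Y2 z" for z
  have "fps_poly_at t c2 * fps_deriv (fps_deriv F) + fps_poly_at t c1 * fps_deriv F + fps_poly_at t c0 * F
      = fps_const x1 * (fps_poly_at t c2 * fps_deriv (fps_deriv F1) + fps_poly_at t c1 * fps_deriv F1 + fps_poly_at t c0 * F1)
      + fps_const x2 * (fps_poly_at t c2 * fps_deriv (fps_deriv F2) + fps_poly_at t c1 * fps_deriv F2 + fps_poly_at t c0 * F2)"
    by (simp add: F_def algebra_simps)
  then have odeF: "fps_poly_at t c2 * fps_deriv (fps_deriv F) + fps_poly_at t c1 * fps_deriv F + fps_poly_at t c0 * F = 0"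
    by (simp only: 1(5) 2(5) mult_zero_right add_0)
  have n0: "fps_nth (fps_poly_at t p) 0 = poly p t" for p
    by (simp add: poly_pcompose flip: poly_0_coeff_0)
  have n1: "fps_nth (fps_poly_at t c2) 1 = poly (pderiv c2) t"
  proof -
    have "fps_nth (fps_deriv (fps_poly_at t c2)) 0 = poly (pderiv c2) t"
      unfolding fps_of_poly_pderiv[symmetric]
      by (simp add: pderiv_pcompose pderiv_pCons poly_pcompose flip: poly_0_coeff_0)
    then show ?thesis
      by simp
  qed
  have "F = 0"
  proof (rule fps_exponents[OF _ n1 c2(2) _ odeF])
    show "fps_nth (fps_poly_at t c2) 0 = 0"
      by (simp only: n0 c2)
    show "fps_nth (fps_poly_at t c1) 0 = - of_nat m * poly (pderiv c2) t"
      by (simp only: n0 c1)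
    show "fps_nth F 0 = 0"
      by (rule van[OF odeF])
    show "fps_nth F (Suc m) = 0"
      using x(2) by (simp add: F_def)
  qed
  moreover have "(\<lambda>w. Y (t + w)) has_fps_expansion F"
    unfolding Y_def F_def by (intro has_fps_expansion_add has_fps_expansion_cmult_left 1 2)
  ultimately have "eventually (\<lambda>w. Y (t + w) = 0) (nhds 0)"
    by (simp add: has_fps_expansion_0_iff)
  then obtain \<epsilon> where eps: "\<epsilon> > 0" "\<And>w. dist w 0 < \<epsilon> \<Longrightarrow> Y (t + w) = 0"
    unfolding eventually_nhds_metric by blast
  have Yhol: "Y holomorphic_on ball t r"
    unfolding Y_def by (intro holomorphic_intros 1 2)
  have Y0: "Y z = 0" if "z \<in> ball t r" for z
  proof (rule analytic_continuation_open[of "ball t (min \<epsilon> r)" "ball t r" Y "\<lambda>_. 0"])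
    show "Y z = 0" if "z \<in> ball t (min \<epsilon> r)" for z
      using that eps(2)[of "z - t"] by (simp add: dist_norm norm_minus_commute)
  qed (use eps(1) r Yhol that in auto)
  have z0r: "z0 \<in> ball t r"
    using z0 r'(2) by auto
  have "eventually (\<lambda>z. z \<in> ball t r) (nhds z0)"
    using z0r by (intro eventually_nhds_in_open) auto
  then have "eventually (\<lambda>z. Y z = 0) (nhds z0)"
    by (rule eventually_mono) (rule Y0)
  from deriv_cong_ev[OF this refl] have "Y z0 = 0" "deriv Y z0 = 0"
    using Y0[OF z0r] by simp_all
  moreover have "deriv Y z0 = x1 * deriv Y1 z0 + x2 * deriv Y2 z0"
    unfolding Y_def using z0r 1(1) 2(1)
    by (intro DERIV_imp_deriv) (auto intro!: derivative_eq_intros holomorphic_derivI[of _ "ball t r"])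
  ultimately show False
    using x(1) 1(2,3) 2(2,3) by (simp add: Y_def)
qed

section \<open>Casoratians\<close>

text \<open>Row \<open>l\<close> holds the \<open>l\<close>-th shifts of the sequences \<open>u\<^sub>k\<^sup>x G\<^sub>k(x)\<close>, freed from the common factor
  \<open>u\<^sub>k\<^sup>x\<close> of column \<open>k\<close>.\<close>

definition casorati_row :: "(nat \<Rightarrow> complex) \<Rightarrow> (nat \<Rightarrow> complex poly) \<Rightarrow> nat \<Rightarrow> nat \<Rightarrow> complex poly" where
  "casorati_row u G l k = smult (u k ^ l) (shift_poly l (G k))"

definition casoratian :: "nat \<Rightarrow> (nat \<Rightarrow> complex) \<Rightarrow> (nat \<Rightarrow> complex poly) \<Rightarrow> complex poly" where
  "casoratian M u G = Determinant.det (mat M M (\<lambda>(i, k). casorati_row u G i k))"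

lemma casorati_row_Suc: "casorati_row u G (Suc l) k = smult (u k) (shift_poly 1 (casorati_row u G l k))"
  using shift_poly_shift_poly[where i = 1 and j = l and p = "G k"]
  by (simp add: casorati_row_def pcompose_smult)

lemma permutes_lt: "p permutes {0..<M} \<Longrightarrow> i < M \<Longrightarrow> p i < (M :: nat)"
  using permutes_in_image[of p "{0..<M}" i] by simp

lemma smult_sum_distrib: "smult c (sum f A) = (\<Sum>i\<in>A. smult c (f i))"
  by (induction A rule: infinite_finite_induct) (simp_all add: smult_add_right)

lemma sign_cases: "(signof p :: 'a :: comm_ring_1) = 1 \<or> (signof p :: 'a) = -1"
  by (simp add: sign_def)

lemma casoratian_shift:
  "Determinant.det (mat M M (\<lambda>(i, k). casorati_row u G (Suc i) k))
    = smult (\<Prod>k<M. u k) (shift_poly 1 (casoratian M u G))"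
proof -
  have "(\<Prod>i = 0..<M. casorati_row u G (Suc i) (p i))
      = smult (\<Prod>k<M. u k) (shift_poly 1 (\<Prod>i = 0..<M. casorati_row u G i (p i)))"
    if "p permutes {0..<M}" for p
  proof -
    have "(\<Prod>i = 0..<M. u (p i)) = (\<Prod>k<M. u k)"
      using prod.permute[OF that, of u] by (simp add: o_def atLeast0LessThan)
    moreover have "(\<Prod>i\<in>A. smult (u (p i)) (f i)) = smult (\<Prod>i\<in>A. u (p i)) (\<Prod>i\<in>A. f i)" for A f
      by (rule prod_smult)
    ultimately show ?thesis
      by (simp add: casorati_row_Suc pcompose_prod)
  qed
  moreover have "signof p * smult c (shift_poly 1 f) = smult c (shift_poly 1 (signof p * f))" for p f c
    using sign_cases[of p, where 'a = "complex poly"] by (auto simp: pcompose_uminus)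
  ultimately show ?thesis
    unfolding casoratian_def
    by (subst (1 2) det_def'[of _ M]) (auto simp: pcompose_sum smult_sum_distrib permutes_lt intro!: sum.cong)
qed

text \<open>The \<open>A k\<close> are the cofactors of row 0. Replacing that row by row \<open>l\<close> produces a repeated row if
  \<open>0 < l < M\<close>; for \<open>l = M\<close> a cyclic permutation of the rows, of sign \<open>(-1)\<^sup>M\<^sup>-\<^sup>1\<close>, produces the Casoratian
  shifted by one.\<close>

lemma casoratian_elimination:
  fixes u :: "nat \<Rightarrow> complex" and G :: "nat \<Rightarrow> complex poly"
  assumes "0 < M"
  obtains A where
    "(\<Sum>k<M. A k * casorati_row u G 0 k) = casoratian M u G"
    "\<And>l. 0 < l \<Longrightarrow> l < M \<Longrightarrow> (\<Sum>k<M. A k * casorati_row u G l k) = 0"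
    "(\<Sum>k<M. A k * casorati_row u G M k)
      = smult ((-1) ^ (M - 1) * (\<Prod>k<M. u k)) (shift_poly 1 (casoratian M u G))"
proof -
  define B where "B r = mat M M (\<lambda>(i, k). if i = 0 then r k else casorati_row u G i k)" for r
  have B: "B r \<in> carrier_mat M M" for r
    by (simp add: B_def)
  have md: "mat_delete (B r) 0 k = mat_delete (B (\<lambda>_. 0)) 0 k" for r k
    by (rule eq_matI) (auto simp: mat_delete_def B_def)
  have cof: "cofactor (B r) 0 k = cofactor (B (\<lambda>_. 0)) 0 k" for r k
    unfolding cofactor_def md[of r k] ..
  have exp: "Determinant.det (B r) = (\<Sum>k<M. cofactor (B (\<lambda>_. 0)) 0 k * r k)" for r
  proof -
    have "B r $$ (0, k) = r k" if "k < M" for k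
      using that assms by (simp add: B_def)
    then show ?thesis
      by (subst laplace_expansion_row[OF B assms]) (auto simp: cof[of r] mult.commute intro!: sum.cong)
  qed
  show ?thesis
  proof (rule that[of "\<lambda>k. cofactor (B (\<lambda>_. 0)) 0 k"], unfold exp[symmetric])
    have "B (casorati_row u G 0) = mat M M (\<lambda>(i, k). casorati_row u G i k)"
      by (rule eq_matI) (auto simp: B_def)
    then show "Determinant.det (B (casorati_row u G 0)) = casoratian M u G"
      by (simp add: casoratian_def)
    show "Determinant.det (B (casorati_row u G l)) = 0" if "0 < l" "l < M" for l
    proof (rule det_identical_rows[OF B, of 0 l])
      show "row (B (casorati_row u G l)) 0 = row (B (casorati_row u G l)) l"
        using that by (intro eq_vecI) (auto simp: B_def)
    qed (use that in auto)
    define C where "C = mat M M (\<lambda>(i, k). casorati_row u G (Suc i) k)"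
    have C: "C \<in> carrier_mat M M"
      by (simp add: C_def)
    have "swap_row_to_front C (M - 1) = B (casorati_row u G M)"
      using assms by (subst swap_row_to_front_result[OF C]) (auto simp: B_def C_def intro!: eq_matI)
    then have "Determinant.det (B (casorati_row u G M)) = (-1) ^ (M - 1) * Determinant.det C"
      using swap_row_to_front_det[OF C, of "M - 1"] assms by simp
    also have "\<dots> = smult ((-1) ^ (M - 1) * (\<Prod>k<M. u k)) (shift_poly 1 (casoratian M u G))"
      unfolding C_def casoratian_shift by (cases "even (M - 1)") auto
    finally show "Determinant.det (B (casorati_row u G M))
      = smult ((-1) ^ (M - 1) * (\<Prod>k<M. u k)) (shift_poly 1 (casoratian M u G))" .
  qed
qed

lemma coeff_prod_top:
  fixes f :: "'b \<Rightarrow> complex poly"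
  assumes "\<And>i. i \<in> A \<Longrightarrow> degree (f i) \<le> n i"
  shows "degree (\<Prod>i\<in>A. f i) \<le> (\<Sum>i\<in>A. n i)
    \<and> coeff (\<Prod>i\<in>A. f i) (\<Sum>i\<in>A. n i) = (\<Prod>i\<in>A. coeff (f i) (n i))"
  using assms
proof (induction A rule: infinite_finite_induct)
  case (insert a A)
  define P where "P = (\<Prod>i\<in>A. f i)"
  define S where "S = (\<Sum>i\<in>A. n i)"
  have IH: "degree P \<le> S" "coeff P S = (\<Prod>i\<in>A. coeff (f i) (n i))"
    using insert by (auto simp: P_def S_def)
  have a: "degree (f a) \<le> n a"
    using insert by auto
  have "coeff (f a * P) (n a + S) = (\<Sum>j\<le>n a + S. coeff (f a) j * coeff P (n a + S - j))"
    by (rule coeff_mult)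
  also have "\<dots> = (\<Sum>j\<in>{n a}. coeff (f a) j * coeff P (n a + S - j))"
  proof (rule sum.mono_neutral_right)
    show "\<forall>j\<in>{..n a + S} - {n a}. coeff (f a) j * coeff P (n a + S - j) = 0"
    proof
      fix j assume "j \<in> {..n a + S} - {n a}"
      then have "degree (f a) < j \<or> degree P < n a + S - j"
        using a IH(1) by auto
      then show "coeff (f a) j * coeff P (n a + S - j) = 0"
        by (auto intro: coeff_eq_0)
    qed
  qed auto
  finally have "coeff (f a * P) (n a + S) = coeff (f a) (n a) * coeff P S"
    by simp
  moreover have "degree (f a * P) \<le> n a + S"
    using degree_mult_le[of "f a" P] a IH(1) by linarith
  ultimately show ?case
    using insert.hyps IH(2) by (simp add: P_def S_def)
qed simp_all

text \<open>A vector in the kernel of the transposed matrix is the coefficient vector of a polynomial of degree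
  less than \<open>M\<close> with \<open>M\<close> roots.\<close>

lemma vandermonde_nonzero:
  fixes u :: "nat \<Rightarrow> complex"
  assumes u: "inj_on u {..<M}"
  shows "Determinant.det (mat M M (\<lambda>(i, k). u k ^ i)) \<noteq> 0"
proof
  define V where "V = mat M M (\<lambda>(k, i). u k ^ i)"
  have V: "V \<in> carrier_mat M M"
    by (simp add: V_def)
  have "transpose_mat V = mat M M (\<lambda>(i, k). u k ^ i)"
    by (rule eq_matI) (auto simp: V_def)
  moreover assume "Determinant.det (mat M M (\<lambda>(i, k). u k ^ i)) = 0"
  ultimately have "Determinant.det V = 0"
    using det_transpose[OF V] by simp
  then obtain v where v: "v \<in> carrier_vec M" "v \<noteq> 0\<^sub>v M" "V *\<^sub>v v = 0\<^sub>v M"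
    using det_0_iff_vec_prod_zero[OF V] by blast
  define p where "p = (\<Sum>i<M. monom (vec_index v i) i)"
  have "poly p (u k) = 0" if "k < M" for k
  proof -
    have "vec_index (V *\<^sub>v v) k = 0"
      using v(3) that by simp
    then show ?thesis
      using that v(1) by (simp add: V_def p_def poly_sum poly_monom scalar_prod_def mult.commute
          atLeast0LessThan)
  qed
  moreover have "degree p < M \<or> p = 0"
  proof (cases M)
    case (Suc M')
    then have "degree p \<le> M'"
      unfolding p_def by (intro degree_sum_le) (auto intro: order.trans[OF degree_monom_le])
    with Suc show ?thesis
      by simp
  qed (simp add: p_def)
  moreover have "card (u ` {..<M}) = M"
    using u by (simp add: card_image)
  ultimately have "p = 0"
    using card_poly_roots_bound[of p] card_mono[of "{x. poly p x = 0}" "u ` {..<M}"] poly_roots_finite[of p]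
    by fastforce
  moreover have "coeff p i = vec_index v i" if "i < M" for i
  proof -
    have "coeff p i = (\<Sum>j<M. if j = i then vec_index v j else 0)"
      unfolding p_def coeff_sum by (intro sum.cong) auto
    with that show ?thesis
      by simp
  qed
  ultimately have "vec_index v i = 0" if "i < M" for i
    using that by simp
  then have "v = 0\<^sub>v M"
    using v(1) by (intro eq_vecI) auto
  with v(2) show False
    by contradiction
qed

lemma coeff_shift_top:
  fixes G :: "complex poly"
  assumes "degree G \<le> d"
  shows "coeff (pcompose G [:a, 1:]) d = coeff G d"
  using coeff_shift_remainder[OF assms, of d a] assms by (simp add: coeff_pderiv coeff_eq_0)

text \<open>The coefficient of highest possible degree of the determinant only involves the leading coefficients of
  its entries, and these form a Vandermonde matrix.\<close>

lemma casoratian_top: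
  assumes u: "inj_on u {..<M}"
    and G: "\<And>k. k < M \<Longrightarrow> degree (G k) \<le> \<mu> k" "\<And>k. k < M \<Longrightarrow> coeff (G k) (\<mu> k) = 1"
  shows "degree (casoratian M u G) \<le> (\<Sum>k<M. \<mu> k)" and "coeff (casoratian M u G) (\<Sum>k<M. \<mu> k) \<noteq> 0"
proof -
  define P where "P p = (\<Prod>i = 0..<M. casorati_row u G i (p i))" for p
  have deg: "degree (casorati_row u G i k) \<le> \<mu> k" if "k < M" for i k
    using G(1)[OF that] degree_smult_le[of "u k ^ i" "shift_poly i (G k)"]
    by (simp add: casorati_row_def degree_pcompose)
  have co: "coeff (casorati_row u G i k) (\<mu> k) = u k ^ i" if "k < M" for i k
    using G that by (simp add: casorati_row_def coeff_shift_top)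
  have P: "degree (P p) \<le> (\<Sum>k<M. \<mu> k)" "coeff (P p) (\<Sum>k<M. \<mu> k) = (\<Prod>i = 0..<M. u (p i) ^ i)"
    if "p permutes {0..<M}" for p
  proof -
    have *: "(\<Sum>i = 0..<M. \<mu> (p i)) = (\<Sum>k<M. \<mu> k)"
      using sum.permute[OF that, of \<mu>] by (simp add: o_def atLeast0LessThan)
    have "degree (P p) \<le> (\<Sum>i = 0..<M. \<mu> (p i)) \<and> coeff (P p) (\<Sum>i = 0..<M. \<mu> (p i))
        = (\<Prod>i = 0..<M. coeff (casorati_row u G i (p i)) (\<mu> (p i)))"
      unfolding P_def using that by (intro coeff_prod_top deg) (simp add: permutes_lt)
    then show "degree (P p) \<le> (\<Sum>k<M. \<mu> k)" "coeff (P p) (\<Sum>k<M. \<mu> k) = (\<Prod>i = 0..<M. u (p i) ^ i)"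
      using that by (auto simp: * co permutes_lt)
  qed
  have cas: "casoratian M u G = (\<Sum>p | p permutes {0..<M}. signof p * P p)"
    unfolding casoratian_def P_def by (subst det_def'[of _ M]) (auto simp: permutes_lt intro!: sum.cong)
  have sg: "degree (signof p * P p) = degree (P p)" "coeff (signof p * P p) i = signof p * coeff (P p) i" for p i
    by (simp_all add: sign_def)
  show "degree (casoratian M u G) \<le> (\<Sum>k<M. \<mu> k)"
    unfolding cas by (intro degree_sum_le) (auto simp: sg P finite_permutations)
  have "coeff (casoratian M u G) (\<Sum>k<M. \<mu> k) = Determinant.det (mat M M (\<lambda>(i, k). u k ^ i))"
    unfolding cas
    by (subst det_def'[of _ M]) (auto simp: permutes_lt coeff_sum sg P intro!: sum.cong)
  with vandermonde_nonzero[OF u] show "coeff (casoratian M u G) (\<Sum>k<M. \<mu> k) \<noteq> 0"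
    by simp
qed

section \<open>Left multiples with two terms\<close>

text \<open>Subtracting the zero operator \<open>(T G)(\<theta>)\<close> from \<open>G(\<theta>) L\<close> replaces every \<open>z\<^sup>j\<close> by \<open>z\<^sup>j - t\<^sup>j\<close>,
  which is a multiple of \<open>z - t\<close>.\<close>

lemma divide_by_linear:
  assumes G: "mellin_op n t q G = 0"
  shows "mult_op (1 / (rf_z - rf_const t)) * (theta_poly G * (\<Sum>j\<le>n. zop ^ j * theta_poly (q j)))
    = (\<Sum>j\<le>n. \<Sum>i<j. zop ^ i * theta_poly (smult (t ^ (j - Suc i)) (shift_poly j G * q j)))"
proof -
  define R where "R j = shift_poly j G * q j" for j
  have pow: "zop ^ j - cop (t ^ j)
      = mult_op (rf_z - rf_const t) * (\<Sum>i<j. zop ^ i * cop (t ^ (j - Suc i)))" for j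
  proof -
    have c: "rf_const (t ^ i) = rf_const t ^ i" for i
      by (induction i) (simp_all add: rf_const_mult)
    have "rf_z ^ j - rf_const (t ^ j)
        = (rf_z - rf_const t) * (\<Sum>i<j. rf_z ^ i * rf_const (t ^ (j - Suc i)))"
      unfolding c power_diff_sumr2 by (simp add: mult.commute)
    from arg_cong[OF this, of mult_op] show ?thesis
      by (simp only: mult_op_power mult_op_diff mult_op_mult mult_op_sum)
  qed
  have "theta_poly G * (\<Sum>j\<le>n. zop ^ j * theta_poly (q j)) = (\<Sum>j\<le>n. zop ^ j * theta_poly (R j))"
    unfolding sum_distrib_left mult.assoc[symmetric] theta_poly_zop_power
    by (simp add: R_def theta_poly_mult mult.assoc)
  also have "\<dots> = (\<Sum>j\<le>n. zop ^ j * theta_poly (R j)) - theta_poly (mellin_op n t q G)"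
    by (simp add: G)
  also have "\<dots> = (\<Sum>j\<le>n. (zop ^ j - cop (t ^ j)) * theta_poly (R j))"
    by (simp add: mellin_op_def R_def theta_poly_sum theta_poly_smult left_diff_distrib sum_subtractf)
  also have "\<dots> = mult_op (rf_z - rf_const t)
      * (\<Sum>j\<le>n. \<Sum>i<j. zop ^ i * theta_poly (smult (t ^ (j - Suc i)) (R j)))"
    by (simp only: pow theta_poly_smult sum_distrib_left sum_distrib_right mult.assoc)
  finally have *: "theta_poly G * (\<Sum>j\<le>n. zop ^ j * theta_poly (q j))
    = mult_op (rf_z - rf_const t)
      * (\<Sum>j\<le>n. \<Sum>i<j. zop ^ i * theta_poly (smult (t ^ (j - Suc i)) (R j)))" .
  have "mult_op (1 / (rf_z - rf_const t)) * mult_op (rf_z - rf_const t) = 1"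
    by (simp add: linear_nonzero flip: mult_op_mult)
  then show ?thesis
    unfolding * R_def[symmetric] by (simp add: mult.assoc[symmetric])
qed

text \<open>In \<open>D L\<close> the terms \<open>z\<^sup>i q\<^sub>j\<close> have the factor \<open>c\<^sub>j\<^sub>-\<^sub>i\<close>, so of those with \<open>i \<ge> 1\<close> only \<open>i = 1\<close>, \<open>j = M + 1\<close>
  survives. The terms with \<open>i = 0\<close> add up to \<open>- c\<^sub>0 q\<^sub>0\<close> because \<open>\<Sum>j. c\<^sub>j q\<^sub>j\<close> is a combination
  of the polynomials \<open>T G\<^sub>k\<close>, which are zero.\<close>

lemma casoratian_left_multiple:
  assumes M: "0 < M"
    and G: "\<And>k. k < M \<Longrightarrow> mellin_op (Suc M) (u k) q (G k) = 0"
  obtains D where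
    "D * (\<Sum>j\<le>Suc M. zop ^ j * theta_poly (q j))
      = zop * theta_poly (smult ((-1) ^ (M - 1) * (\<Prod>k<M. u k)) (shift_poly 2 (casoratian M u G)) * q (Suc M))
        - theta_poly (casoratian M u G * q 0)"
proof -
  obtain A where A: "(\<Sum>k<M. A k * casorati_row u G 0 k) = casoratian M u G"
    "\<And>l. 0 < l \<Longrightarrow> l < M \<Longrightarrow> (\<Sum>k<M. A k * casorati_row u G l k) = 0"
    "(\<Sum>k<M. A k * casorati_row u G M k)
      = smult ((-1) ^ (M - 1) * (\<Prod>k<M. u k)) (shift_poly 1 (casoratian M u G))"
    by (rule casoratian_elimination[OF M, of u G]) (rule that)
  define C where "C l = (\<Sum>k<M. A k * casorati_row u G l k)" for l
  define L where "L = (\<Sum>j\<le>Suc M. zop ^ j * theta_poly (q j))"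
  \<comment> \<open>The factor \<open>u k\<close> compensates for \<open>t ^ (j - 1 - i)\<close> in the quotient of \<open>z\<^sup>j - t\<^sup>j\<close>, so that rows of the Casorati
    matrix appear with the exponent \<open>j - i\<close>.\<close>
  define D where "D = (\<Sum>k<M. theta_poly (A k) * cop (u k) * (mult_op (1 / (rf_z - rf_const (u k))) * theta_poly (G k)))"
  define f where "f i j = zop ^ i * theta_poly (shift_poly i (C (j - i)) * q j)" for i j
  have summand: "theta_poly (A k) * cop (u k) * (zop ^ i * theta_poly (smult (u k ^ (j - Suc i)) (shift_poly j (G k) * q j)))
      = zop ^ i * theta_poly (shift_poly i (A k * casorati_row u G (j - i) k) * q j)"
    if "i < j" for i j k
  proof -
    have "u k * u k ^ (j - Suc i) = u k ^ (j - i)"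
      using that by (simp flip: power_Suc add: Suc_diff_Suc)
    then have r: "smult (u k) (smult (u k ^ (j - Suc i)) (shift_poly j (G k) * q j))
        = shift_poly i (casorati_row u G (j - i) k) * q j"
      using that shift_poly_shift_poly[where i = i and j = "j - i" and p = "G k"]
      by (simp add: casorati_row_def pcompose_smult)
    have "theta_poly (A k) * cop (u k) * (zop ^ i * theta_poly P)
        = zop ^ i * theta_poly (shift_poly i (A k) * smult (u k) P)" for P
    proof -
      have "cop (u k) * zop ^ i = zop ^ i * cop (u k)"
        using mult_op_commute[of "rf_const (u k)" "rf_z ^ i"] by (simp only: mult_op_power)
      then have "theta_poly (A k) * (cop (u k) * zop ^ i) * theta_poly P
          = theta_poly (A k) * (zop ^ i * cop (u k)) * theta_poly P"
        by (simp only:)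
      then have "theta_poly (A k) * cop (u k) * (zop ^ i * theta_poly P)
          = (theta_poly (A k) * zop ^ i) * (cop (u k) * theta_poly P)"
        by (simp only: mult.assoc)
      then show ?thesis
        by (simp add: theta_poly_zop_power theta_poly_mult theta_poly_smult mult.assoc
            del: mult_smult_right)
    qed
    then show ?thesis
      by (simp only: r pcompose_mult mult.assoc)
  qed
  have "D * L = (\<Sum>k<M. \<Sum>j\<le>Suc M. \<Sum>i<j. zop ^ i * theta_poly (shift_poly i (A k * casorati_row u G (j - i) k) * q j))"
    unfolding D_def L_def sum_distrib_right mult.assoc
  proof (intro sum.cong refl)
    fix k assume "k \<in> {..<M}"
    then have k: "mellin_op (Suc M) (u k) q (G k) = 0"
      using G by simp
    show "theta_poly (A k) * (cop (u k) * (mult_op (1 / (rf_z - rf_const (u k))) *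
          (theta_poly (G k) * (\<Sum>j\<le>Suc M. zop ^ j * theta_poly (q j)))))
        = (\<Sum>j\<le>Suc M. \<Sum>i<j. zop ^ i * theta_poly (shift_poly i (A k * casorati_row u G (j - i) k) * q j))"
      unfolding divide_by_linear[OF k]
      unfolding mult.assoc[symmetric, of "theta_poly (A k)"] sum_distrib_left
      by (intro sum.cong refl summand) simp
  qed
  also have "\<dots> = (\<Sum>j\<le>Suc M. \<Sum>i<j. f i j)"
  proof -
    have f: "f i j = (\<Sum>k<M. zop ^ i * theta_poly (shift_poly i (A k * casorati_row u G (j - i) k) * q j))" for i j
      by (simp add: f_def C_def pcompose_sum theta_poly_sum sum_distrib_left sum_distrib_right)
    have "(\<Sum>i<j. f i j) = (\<Sum>k<M. \<Sum>i<j. zop ^ i * theta_poly (shift_poly i (A k * casorati_row u G (j - i) k) * q j))" for j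
      unfolding f by (rule sum.swap)
    then show ?thesis
      by (simp only:) (rule sum.swap)
  qed
  also have "\<dots> = (\<Sum>j=1..Suc M. f 0 j) + f 1 (Suc M)"
  proof -
    have "(\<Sum>i<j. f i j) = f 0 j + (if j = Suc M then f 1 (Suc M) else 0)" if "1 \<le> j" "j \<le> Suc M" for j
    proof -
      have f0: "f i j = 0" if "1 \<le> i" "i < j" "\<not> (i = 1 \<and> j = Suc M)" for i
      proof -
        have "C (j - i) = 0"
          unfolding C_def using that \<open>j \<le> Suc M\<close> by (intro A(2)) auto
        then show ?thesis
          by (simp add: f_def)
      qed
      have "{..<j} = insert 0 {1..<j}"
        using \<open>1 \<le> j\<close> by auto
      then have "(\<Sum>i<j. f i j) = f 0 j + (\<Sum>i\<in>{1..<j}. f i j)"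
        by simp
      also have "(\<Sum>i\<in>{1..<j}. f i j) = (\<Sum>i\<in>{1..<j}. if i = 1 then if j = Suc M then f 1 (Suc M) else 0 else 0)"
        by (intro sum.cong refl) (auto simp: f0)
      also have "\<dots> = (if j = Suc M then f 1 (Suc M) else 0)"
        using M by (auto simp: sum.delta)
      finally show ?thesis .
    qed
    moreover have "(\<Sum>j\<le>Suc M. \<Sum>i<j. f i j) = (\<Sum>j=1..Suc M. \<Sum>i<j. f i j)"
      by (intro sum.mono_neutral_right) (auto simp: not_le)
    ultimately show ?thesis
      by (simp add: sum.distrib)
  qed
  also have "(\<Sum>j=1..Suc M. f 0 j) = - theta_poly (C 0 * q 0)"
  proof -
    have "(\<Sum>j\<le>Suc M. C j * q j) = (\<Sum>k<M. A k * mellin_op (Suc M) (u k) q (G k))"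
      unfolding C_def mellin_op_def sum_distrib_left sum_distrib_right
      by (subst sum.swap) (simp add: casorati_row_def mult.assoc)
    also have "\<dots> = 0"
      using G by simp
    finally have "theta_poly (\<Sum>j\<le>Suc M. C j * q j) = 0"
      by simp
    moreover have "{..Suc M} = insert 0 {1..Suc M}"
      by auto
    ultimately have "theta_poly (C 0 * q 0) + (\<Sum>j=1..Suc M. theta_poly (C j * q j)) = 0"
      by (simp add: theta_poly_add theta_poly_sum)
    then show ?thesis
      by (simp add: f_def eq_neg_iff_add_eq_0 add.commute)
  qed
  finally have "D * L = f 1 (Suc M) - theta_poly (C 0 * q 0)"
    by simp
  moreover have "shift_poly 1 (C M)
      = smult ((-1) ^ (M - 1) * (\<Prod>k<M. u k)) (shift_poly 2 (casoratian M u G))"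
    using shift_poly_shift_poly[where i = 1 and j = 1] by (simp add: C_def A(3) pcompose_smult)
  ultimately show ?thesis
    using that[of D] A(1) by (simp add: L_def f_def C_def)
qed

section \<open>The hypergeometric left multiple\<close>

text \<open>The constant \<open>c\<close> of \<open>exists_mellin_op_const\<close> annihilates the value at \<open>t\<close> of every holomorphic
  solution, so a solution that does not vanish there forces \<open>c = 0\<close>.\<close>

lemma apparent_mellin_kernel:
  fixes b2 b1 b0 :: "complex poly"
  assumes n: "degree b2 \<le> n" "degree b1 \<le> n" "degree b0 \<le> n"
    and t: "poly b2 t = 0" "poly (pderiv b2) t \<noteq> 0" "t \<noteq> 0"
    and b1: "poly b1 t = - of_nat m * t * poly (pderiv b2) t"
    and app: "apparent_at (d_dz ^ 2 + mult_op (to_fract b1 / (rf_z * to_fract b2)) * d_dz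
      + mult_op (to_fract b0 / (rf_z\<^sup>2 * to_fract b2))) t"
  shows "\<exists>G. degree G \<le> m \<and> coeff G m = 1 \<and> mellin_op n t (euler_coeff b2 b1 b0) G = 0"
proof -
  define x where "x = [:0, 1 :: complex:]"
  have x: "to_fract x = rf_z" "poly x t = t" "pderiv x = 1" "fps_poly_at t x = fps_z t"
    by (simp_all add: x_def rf_z_def pderiv_pCons one_pCons pcompose_pCons mult_pCons_left fps_of_poly_pCons)
  have "to_fract (x * b1) / to_fract (x ^ 2 * b2) = to_fract b1 / (rf_z * to_fract b2)"
    "to_fract b0 / to_fract (x ^ 2 * b2) = to_fract b0 / (rf_z\<^sup>2 * to_fract b2)"
    by (simp_all add: x(1) power2_eq_square)
  with app have app': "apparent_at (d_dz ^ 2 + mult_op (to_fract (x * b1) / to_fract (x ^ 2 * b2)) * d_dz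
      + mult_op (to_fract b0 / to_fract (x ^ 2 * b2))) t"
    by (simp only:)
  have p2: "poly (pderiv (x ^ 2 * b2)) t = t\<^sup>2 * poly (pderiv b2) t"
    using t(1) by (simp add: pderiv_mult x(2))
  have "\<exists>F. fps_nth F 0 \<noteq> 0 \<and> fps_poly_at t (x ^ 2 * b2) * fps_deriv (fps_deriv F)
      + fps_poly_at t (x * b1) * fps_deriv F + fps_poly_at t b0 * F = 0"
  proof (rule apparent_nonvanishing_solution[OF app'])
    show "poly (x ^ 2 * b2) t = 0"
      by (simp add: t(1))
    show "poly (pderiv (x ^ 2 * b2)) t \<noteq> 0"
      using t by (simp add: p2)
    show "poly (x * b1) t = - of_nat m * poly (pderiv (x ^ 2 * b2)) t"
      unfolding p2 by (simp add: x(2) b1 power2_eq_square)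
  qed
  then obtain F where F: "fps_nth F 0 \<noteq> 0" and ode: "fps_poly_at t (x ^ 2 * b2) * fps_deriv (fps_deriv F)
      + fps_poly_at t (x * b1) * fps_deriv F + fps_poly_at t b0 * F = 0"
    by blast
  have "fps_poly_at t (x ^ 2 * b2) = fps_z t ^ 2 * fps_poly_at t b2"
    "fps_poly_at t (x * b1) = fps_z t * fps_poly_at t b1"
    by (simp_all only: pcompose_mult power2_eq_square fps_of_poly_mult x(4))
  with ode have "(\<Sum>j\<le>n. fps_z t ^ j * theta_fps t (euler_coeff b2 b1 b0 j) F) = 0"
    by (simp only: euler_form_fps[OF n])
  note ann = theta_fps_mellin_op[OF this]
  obtain G c where G: "degree G \<le> m" "coeff G m = 1" "mellin_op n t (euler_coeff b2 b1 b0) G = [:c:]"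
    using exists_mellin_op_const[OF n t b1] by blast
  have "c * fps_nth F 0 = 0"
    using ann[of G] by (simp add: G(3))
  with F G show ?thesis
    by auto
qed

lemma complex_poly_splits:
  fixes p :: "complex poly"
  assumes "p \<noteq> 0"
  obtains es where "length es = degree p" "p = smult (lead_coeff p) (\<Prod>e\<leftarrow>es. [:e, 1:])"
proof -
  obtain xs where xs: "mset xs = proots p"
    using ex_mset by blast
  have "(\<Prod>e\<leftarrow>map uminus xs. [:e, 1:]) = (\<Prod>x\<in>#proots p. [:- x, 1:])"
    by (simp add: o_def flip: xs prod_mset_prod_list)
  then have "p = smult (lead_coeff p) (\<Prod>e\<leftarrow>map uminus xs. [:e, 1:])"
    using complex_poly_decompose_multiset[of p] by simp
  moreover have "length (map uminus xs) = degree p"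
    using size_proots_complex[of p] by (simp flip: xs)
  ultimately show ?thesis
    using that by blast
qed

text \<open>The polynomial with roots \<open>- e\<^sub>i\<close> is the Casoratian of the \<open>G\<^sub>k\<close>, shifted by one.\<close>

theorem apparent_implies_hypergeometric_factor:
  fixes M :: nat and m :: "nat \<Rightarrow> nat" and \<alpha> \<beta> \<gamma> \<delta> :: complex and s t :: "nat \<Rightarrow> complex"
  defines "N \<equiv> \<Sum>k=1..M. m k"
  assumes M: "M \<ge> 1" and dist: "distinct (0 # 1 # map t [1..<M+1])"
    and app: "\<And>k. k \<in> {1..M} \<Longrightarrow> apparent_at (L_tilde \<gamma> \<delta> M m t s) (t k)"
    and s: "s M = \<alpha> * \<beta>" and \<delta>: "\<delta> = \<alpha> + \<beta> - \<gamma> + of_nat N + 1"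
  shows "\<exists>es D. length es = N \<and> diffop_order D = N \<and>
    hypergeom_op (\<alpha> # \<beta> # map (\<lambda>e. e + 1) es) (\<gamma> # es) = D * L_tilde \<gamma> \<delta> M m t s"
proof -
  define u where "u = t \<circ> Suc"
  define \<mu> where "\<mu> = m \<circ> Suc"
  define b2 where "b2 = sing2 M u"
  define b1 where "b1 = sing1 \<gamma> \<delta> M \<mu> u"
  define b0 where "b0 = sing0 M s"
  define q where "q = euler_coeff b2 b1 b0"
  define L where "L = L_tilde \<gamma> \<delta> M m t s"
  have L: "L = d_dz ^ 2 + mult_op (to_fract b1 / (rf_z * to_fract b2)) * d_dz
      + mult_op (to_fract b0 / (rf_z\<^sup>2 * to_fract b2))"
    unfolding L_def b2_def b1_def b0_def u_def \<mu>_def by (rule L_tilde_eq)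
  have N: "N = (\<Sum>k<M. \<mu> k)"
    unfolding N_def \<mu>_def One_nat_def sum.atLeast1_atMost_eq by simp
  have t_inj: "inj_on t {1..<M+1}"
    using dist by (simp add: distinct_map del: upt_Suc)
  have u_inj: "inj_on u {..<M}"
    unfolding u_def by (rule comp_inj_on, simp) (rule inj_on_subset[OF t_inj], auto)
  have t01: "t k \<noteq> 0 \<and> t k \<noteq> 1" if "k \<in> set [1..<M+1]" for k
    using dist that by fastforce
  have u01: "u k \<noteq> 0" "u k \<noteq> 1" if "k < M" for k
    using t01[of "Suc k"] that by (auto simp: u_def simp del: upt_Suc)
  have n: "degree b2 \<le> Suc M" "degree b1 \<le> Suc M" "degree b0 \<le> Suc M"
    by (simp_all add: b2_def b1_def b0_def degree_sing2 degree_sing1 degree_sing0)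
  have "\<exists>G. degree G \<le> \<mu> k \<and> coeff G (\<mu> k) = 1 \<and> mellin_op (Suc M) (u k) q G = 0" if "k < M" for k
    unfolding q_def
  proof (rule apparent_mellin_kernel[OF n])
    show "poly b2 (u k) = 0"
      unfolding b2_def by (rule poly_sing2_root[OF that])
    show "poly (pderiv b2) (u k) \<noteq> 0"
      unfolding b2_def using u01(2) by (intro poly_pderiv_sing2_nonzero[OF that u_inj]) force
    show "u k \<noteq> 0"
      by (rule u01(1)[OF that])
    show "poly b1 (u k) = - of_nat (\<mu> k) * u k * poly (pderiv b2) (u k)"
      unfolding b1_def b2_def by (rule poly_sing1_root[OF that])
    have "apparent_at L (u k)"
      unfolding L_def u_def o_def using that by (intro app) simp
    then show "apparent_at (d_dz ^ 2 + mult_op (to_fract b1 / (rf_z * to_fract b2)) * d_dz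
        + mult_op (to_fract b0 / (rf_z\<^sup>2 * to_fract b2))) (u k)"
      unfolding L .
  qed
  then obtain G where G: "\<And>k. k < M \<Longrightarrow> degree (G k) \<le> \<mu> k" "\<And>k. k < M \<Longrightarrow> coeff (G k) (\<mu> k) = 1"
    "\<And>k. k < M \<Longrightarrow> mellin_op (Suc M) (u k) q (G k) = 0"
    by metis
  define \<Delta> where "\<Delta> = casoratian M u G"
  define \<kappa> where "\<kappa> = (-1) ^ (M - 1) * (\<Prod>k<M. u k)"
  obtain D where D: "D * (\<Sum>j\<le>Suc M. zop ^ j * theta_poly (q j))
      = zop * theta_poly (smult \<kappa> (shift_poly 2 \<Delta>) * q (Suc M)) - theta_poly (\<Delta> * q 0)"
    unfolding \<Delta>_def \<kappa>_def by (rule casoratian_left_multiple[of M u q G, OF _ G(3)]) (use M in auto)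
  have \<kappa>: "\<kappa> \<noteq> 0"
    using u01 by (simp add: \<kappa>_def)
  have "coeff b2 0 = \<kappa>"
  proof -
    have "(\<Prod>k<M. - u k) = (-1) ^ M * (\<Prod>k<M. u k)"
      using prod.distrib[of "\<lambda>_. -1" u "{..<M}"] by simp
    then show ?thesis
      using M by (cases M) (simp_all add: b2_def coeff_sing2_0 \<kappa>_def)
  qed
  then have q0: "q 0 = smult \<kappa> ([:0, 1:] * [:\<gamma> - 1, 1:])"
    using coeff_sing1_0[of \<gamma> \<delta> M \<mu> u] coeff_sing0_0[of M s]
    by (simp add: q_def euler_coeff_def b1_def b0_def b2_def mult_pCons_left algebra_simps)
  have "\<gamma> + \<delta> - of_nat N = \<alpha> + \<beta> + 1"
    using \<delta> by simp
  then have qM: "q (Suc M) = [:\<alpha>, 1:] * [:\<beta>, 1:]"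
    using coeff_sing1_top[of \<gamma> \<delta> M \<mu> u] coeff_sing2_top[of M u] coeff_sing0_top[of M s]
    by (simp add: q_def euler_coeff_def b1_def b0_def b2_def s N mult_pCons_left)

  have top: "degree \<Delta> \<le> N" "coeff \<Delta> N \<noteq> 0"
    unfolding \<Delta>_def N using casoratian_top[OF u_inj G(1,2)] by auto
  then have deg\<Delta>: "degree \<Delta> = N"
    by (intro antisym le_degree)
  define P where "P = shift_poly 1 \<Delta>"
  have degP: "degree P = N"
    by (simp add: P_def degree_pcompose deg\<Delta>)
  have "coeff P N \<noteq> 0"
    using top by (simp add: P_def coeff_shift_top)
  then have "P \<noteq> 0"
    by auto
  then obtain es where es: "length es = N" "P = smult (lead_coeff P) (\<Prod>e\<leftarrow>es. [:e, 1:])"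
    using complex_poly_splits[of P] degP by metis
  define E where "E = (\<Prod>e\<leftarrow>es. [:e, 1:])"
  define c where "c = lead_coeff P"
  have c: "c \<noteq> 0" "P = smult c E"
    using \<open>P \<noteq> 0\<close> es(2) by (simp_all add: c_def E_def)
  have "\<Delta> = pcompose P [:-1, 1:]"
    by (simp add: P_def pcompose_pCons mult_pCons_left flip: pcompose_assoc)
  then have \<Delta>0: "\<Delta> = smult c (pcompose E [:-1, 1:])"
    by (simp add: c(2) pcompose_smult)
  have "shift_poly 2 \<Delta> = shift_poly 1 P"
    using shift_poly_shift_poly[where i = 1 and j = 1 and p = \<Delta>] by (simp add: P_def)
  then have \<Delta>2: "shift_poly 2 \<Delta> = smult c (shift_poly 1 E)"
    by (simp add: c(2) pcompose_smult)
  define X where "X = theta_poly ([:0, 1:] * [:\<gamma> - 1, 1:] * pcompose E [:-1, 1:])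
      - zop * theta_poly ([:\<alpha>, 1:] * [:\<beta>, 1:] * shift_poly 1 E)"
  define K where "K = mult_op (rf_z\<^sup>2 * to_fract b2)"
  have KL: "K * L = (\<Sum>j\<le>Suc M. zop ^ j * theta_poly (q j))"
    unfolding K_def L q_def by (rule euler_form[OF _ n]) (simp add: b2_def)
  have DKL: "D * (K * L) = - (cop (\<kappa> * c) * X)"
  proof -
    have "smult \<kappa> (shift_poly 2 \<Delta>) * q (Suc M)
        = smult (\<kappa> * c) ([:\<alpha>, 1:] * [:\<beta>, 1:] * shift_poly 1 E)"
      by (simp only: \<Delta>2 qM smult_smult mult_smult_left) (simp only: ac_simps)
    then have "zop * theta_poly (smult \<kappa> (shift_poly 2 \<Delta>) * q (Suc M))
        = zop * (cop (\<kappa> * c) * theta_poly ([:\<alpha>, 1:] * [:\<beta>, 1:] * shift_poly 1 E))"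
      by (simp only: theta_poly_smult)
    also have "\<dots> = cop (\<kappa> * c) * (zop * theta_poly ([:\<alpha>, 1:] * [:\<beta>, 1:] * shift_poly 1 E))"
      by (simp only: mult.assoc[symmetric] cop_commute_zop)
    finally have "zop * theta_poly (smult \<kappa> (shift_poly 2 \<Delta>) * q (Suc M))
        = cop (\<kappa> * c) * (zop * theta_poly ([:\<alpha>, 1:] * [:\<beta>, 1:] * shift_poly 1 E))" .
    moreover have "\<Delta> * q 0 = smult (\<kappa> * c) ([:0, 1:] * [:\<gamma> - 1, 1:] * pcompose E [:-1, 1:])"
      by (subst \<Delta>0, simp only: q0 smult_smult mult_smult_left mult_smult_right) (simp only: ac_simps)
    then have "theta_poly (\<Delta> * q 0)
        = cop (\<kappa> * c) * theta_poly ([:0, 1:] * [:\<gamma> - 1, 1:] * pcompose E [:-1, 1:])"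
      by (simp only: theta_poly_smult)
    ultimately show ?thesis
      unfolding KL D X_def by (simp add: right_diff_distrib)
  qed
  have "cop (- (1 / (\<kappa> * c))) * cop (\<kappa> * c) = cop (- (1 / (\<kappa> * c)) * (\<kappa> * c))"
    by (simp only: mult_op_mult rf_const_mult)
  also have "- (1 / (\<kappa> * c)) * (\<kappa> * c) = -1"
    using \<kappa> c(1) by simp
  also have "cop (-1) = -1"
    by (simp add: rf_const_uminus mult_op_uminus)
  finally have inv: "cop (- (1 / (\<kappa> * c))) * cop (\<kappa> * c) = -1" .
  have X: "X = cop (- (1 / (\<kappa> * c))) * (D * (K * L))"
    unfolding DKL unfolding mult_minus_right mult.assoc[symmetric] inv by simp
  define D' where "D' = mult_op (1 / (rf_z ^ (N + 2) * (1 - rf_z))) * cop (- (1 / (\<kappa> * c))) * D * K"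
  have "hypergeom_op (\<alpha> # \<beta> # map (\<lambda>e. e + 1) es) (\<gamma> # es) = mult_op (1 / (rf_z ^ (N + 2) * (1 - rf_z))) * X"
    unfolding X_def E_def hypergeom_op_eq es(1) ..
  also have "\<dots> = D' * L"
    unfolding X D'_def by (simp only: mult.assoc)
  finally have eq: "hypergeom_op (\<alpha> # \<beta> # map (\<lambda>e. e + 1) es) (\<gamma> # es) = D' * L" .
  have ord: "diffop_order (D' * L) = N + 2"
    unfolding eq[symmetric] by (subst diffop_order_hypergeom_op) (simp_all add: es(1))
  have "diffop_order L = 2"
    unfolding L diffop_order_def diffop_poly_L by simp
  moreover have "D' \<noteq> 0" "L \<noteq> 0"
    using ord by (auto simp: diffop_order_def zero_diffop.rep_eq)
  ultimately have "diffop_order D' = N"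
    using ord by (simp add: diffop_order_mult)
  with es(1) eq show ?thesis
    unfolding L_def by blast
qed

theorem proposition4p1:
  fixes M N :: nat and m :: "nat \<Rightarrow> nat"
    and \<alpha> \<beta> \<gamma> \<delta> :: complex and s t :: "nat \<Rightarrow> complex"
  assumes "M \<ge> 1"
    and "\<forall>k\<in>{1..M}. m k \<ge> 1"
    and "(M = 1 \<and> m 1 \<le> 5) \<or> (M = 2 \<and> m 1 + m 2 \<le> 4) \<or>
         (M = 3 \<and> m 1 = 1 \<and> m 2 = 1 \<and> m 3 = 1)"
    and "N = (\<Sum>k=1..M. m k)"
    and "distinct (0 # 1 # map t [1..<M+1])"
    and "\<forall>k\<in>{1..M}. apparent_at (L_tilde \<gamma> \<delta> M m t s) (t k)"
    and "s M = \<alpha> * \<beta>"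
    and "\<delta> = \<alpha> + \<beta> - \<gamma> + of_nat N + 1"
  shows "\<exists>(es :: complex list) (D :: diffop). length es = N \<and> diffop_order D = N \<and>
    hypergeom_op (\<alpha> # \<beta> # map (\<lambda>e. e + 1) es) (\<gamma> # es) = D * L_tilde \<gamma> \<delta> M m t s"
  using apparent_implies_hypergeometric_factor[of M t \<gamma> \<delta> m s \<alpha> \<beta>] assms by simp

end
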